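(* Let $\kappa$ be of class $\mathcal{G}_2(2,0)$ and $f\in C^2[0,1]$. Let $\varphi$ be the unique solution of $x-\mathcal{K}(x)=f$ and assume that $1$ is not an eigenvalue of $\mathcal{K}'(\varphi)$. Let $\mathcal{X}_n$ be the space of piecewise constant functions with respect to the uniform partition $\{t_j=j/n\}$ and $Q_n:L^\infty[0,1]\to\mathcal{X}_n$ the discrete orthogonal projection (based on the composite Gauss two-point rule). Let $z_n^M$ be the discrete modified projection solution in $\mathcal{B}(\varphi,\delta_0)$. Then $$\|z_n^M-\varphi\|_\infty=O\big(\max\{\tilde h^{2},h^{3}\}\big).$$
   Context: Setting. $\mathcal{X}=L^\infty[0,1]$ with sup norm. A kernel $\kappa:[0,1]\times[0,1]\times\mathbb{R}\to\mathbb{R}$ is of class $\mathcal{G}_2(2,0)$ if: (1) $\ell=\partial\kappa/\partial u$ is continuous on $\Psi=[0,1]^2\times\mathbb{R}$; (2) with $\Psi_1=\{0\le t\le s\le1,u\in\mathbb{R}\}$, $\Psi_2=\{0\le s\le t\le1,u\in\mathbb{R}\}$, there are $\ell_i\in C^{2}(\Psi_i)$ with $\ell=\ell_i$ on $\Psi_i$; (3) there are $\kappa_i\in C^{2}(\Psi_i)$ with $\kappa=\kappa_i$ on $\Psi_i$; (4) $\partial^2\kappa/\partial u^2$ is continuous on $\Psi$. $\mathcal{K}(x)(s)=\int_0^1\kappa(s,t,x(t))dt$, assumed twice Fréchet differentiable. Quadrature: Gauss two-point rule with $w_1=w_2=1/2$, $\mu_{1,2}=\tfrac12\mp\tfrac1{2\sqrt3}$.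 For $n,p\in\mathbb{N}$, $m=np$, $h=1/n$, $\tilde h=1/m$, $s_i=i/m$, $\zeta_q^i=s_{i-1}+\mu_q\tilde h$. Nyström operator $\mathcal{K}_m(x)(s)=\tilde h\sum_{i=1}^m\sum_{q=1}^2 w_q\kappa(s,\zeta_q^i,x(\zeta_q^i))$. Projection: $t_j=j/n$; $\mathcal{X}_n$ consists of functions constant on $[t_0,t_1]$ and on each $(t_{j-1},t_j]$, $j\ge2$. For $v\in C[0,1]$, $(Q_nv)(t)=\frac1p\sum_{\nu=1}^p\sum_{q=1}^2w_qv(\zeta_q^{(j-1)p+\nu})$ for $t\in(t_{j-1},t_j]$ (and at $t=0$ with $j=1$); $Q_n$ is extended to a bounded projection on $L^\infty[0,1]$ via Hahn–Banach. Method: $\tilde{\mathcal{K}}_n^M(x)=Q_n\mathcal{K}_m(x)+\mathcal{K}_m(Q_nx)-Q_n\mathcal{K}_m(Q_nx)$. There is $\delta_0>0$ such that for $n$ large enough $z-\tilde{\mathcal{K}}_n^M(z)=f$ has a unique solution $z_n^M$ in $\mathcal{B}(\varphi,\delta_0)=\{\psi:\|\psi-\varphi\|_\infty<\delta_0\}$. Notation: $A=O(B)$ means $|A|\le CB$ with $C$ independent of $n,p$, for all sufficiently large $n$. *)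

theory Defs
  imports "HOL-Analysis.Analysis"
begin

text \<open>Elements are real functions on the real line, Borel measurable, bounded,
  and vanishing outside [0,1] (so that only the values on [0,1] matter).
  The norm is the supremum norm over [0,1].\<close>

definition "linf_set = {f :: real \<Rightarrow> real. f \<in> borel_measurable borel \<and> bounded (range f)
   \<and> (\<forall>t. t \<notin> {0..1} \<longrightarrow> f t = 0)}"

typedef linf = linf_set
  morphisms fn Linf
  by (rule exI[of _ "\<lambda>_. 0"]) (auto simp: linf_set_def)

setup_lifting type_definition_linf

lemma bounded_range_real_iff: "bounded (range (f::'a \<Rightarrow> real)) \<longleftrightarrow> (\<exists>B. \<forall>x. \<bar>f x\<bar> \<le> B)"
  by (auto simp: bounded_iff)

lemma linf_set_uminus: "f \<in> linf_set \<Longrightarrow> (\<lambda>x. - f x) \<in> linf_set"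
  by (auto simp: linf_set_def bounded_range_real_iff)
lemma linf_set_plus: "f \<in> linf_set \<Longrightarrow> g \<in> linf_set \<Longrightarrow> (\<lambda>x. f x + g x) \<in> linf_set"
  by (auto simp: linf_set_def intro!: bounded_plus_comp)
lemma linf_set_minus: "f \<in> linf_set \<Longrightarrow> g \<in> linf_set \<Longrightarrow> (\<lambda>x. f x - g x) \<in> linf_set"
  by (auto simp: linf_set_def intro!: bounded_minus_comp)
lemma linf_set_scaleR: "f \<in> linf_set \<Longrightarrow> (\<lambda>x. a *\<^sub>R f x) \<in> linf_set"
  apply (auto simp: linf_set_def bounded_range_real_iff abs_mult)
  by (metis abs_ge_zero mult_left_mono)
lemma linf_set_zero: "(\<lambda>_. 0) \<in> linf_set"
  by (auto simp: linf_set_def)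

lemma linf_eqI: "(\<And>x. fn f x = fn g x) \<Longrightarrow> f = g"
  by transfer auto

instantiation linf :: real_vector
begin
lift_definition uminus_linf :: "linf \<Rightarrow> linf" is "\<lambda>f x. - f x" by (rule linf_set_uminus)
lift_definition plus_linf :: "linf \<Rightarrow> linf \<Rightarrow> linf" is "\<lambda>f g x. f x + g x" by (rule linf_set_plus)
lift_definition minus_linf :: "linf \<Rightarrow> linf \<Rightarrow> linf" is "\<lambda>f g x. f x - g x" by (rule linf_set_minus)
lift_definition zero_linf :: "linf" is "\<lambda>_. 0" by (rule linf_set_zero)
lift_definition scaleR_linf :: "real \<Rightarrow> linf \<Rightarrow> linf" is "\<lambda>r g x. r *\<^sub>R g x" by (rule linf_set_scaleR)
lemmas [simp] = uminus_linf.rep_eq plus_linf.rep_eq minus_linf.rep_eq zero_linf.rep_eq scaleR_linf.rep_eq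
instance by standard (auto intro!: linf_eqI simp: algebra_simps)
end

lemma bounded_fn: "bounded (range (fn f))"
  using fn[of f] by (auto simp: linf_set_def)

lemma bdd_fn: "bdd_above (range (\<lambda>t. \<bar>fn f t\<bar>))"
proof -
  obtain B where "\<forall>x. \<bar>fn f x\<bar> \<le> B" using bounded_fn[of f] by (auto simp: bounded_range_real_iff)
  then show ?thesis by (intro bdd_aboveI2[where M=B]) auto
qed

lemma fn_le_SUP: "\<bar>fn f x\<bar> \<le> (SUP t. \<bar>fn f t\<bar>)"
  by (rule cSUP_upper[OF _ bdd_fn]) auto

instantiation linf :: real_normed_vector
begin
definition norm_linf :: "linf \<Rightarrow> real" where "norm_linf f = (SUP t. \<bar>fn f t\<bar>)"
definition dist_linf :: "linf \<Rightarrow> linf \<Rightarrow> real" where "dist_linf f g = norm (f - g)"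
definition sgn_linf :: "linf \<Rightarrow> linf" where "sgn_linf f = f /\<^sub>R norm f"
definition uniformity_linf :: "(linf \<times> linf) filter"
  where "uniformity_linf = (INF e\<in>{0 <..}. principal {(x, y). dist x y < e})"
definition open_linf :: "linf set \<Rightarrow> bool"
  where "open_linf S = (\<forall>x\<in>S. \<forall>\<^sub>F (x', y) in uniformity. x' = x \<longrightarrow> y \<in> S)"
instance
proof
  fix a :: real and f g :: linf
  show "norm f = 0 \<longleftrightarrow> f = 0"
  proof
    assume "norm f = 0"
    then have "\<bar>fn f x\<bar> \<le> 0" for x using fn_le_SUP[of f x] by (simp add: norm_linf_def)
    then show "f = 0" by (intro linf_eqI) simp
  qed (simp add: norm_linf_def)
  show "norm (f + g) \<le> norm f + norm g"
    unfolding norm_linf_def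
    by (auto intro!: cSUP_least add_mono fn_le_SUP order_trans[OF abs_triangle_ineq])
  note bdd = bdd_fn[of f]
  have "(SUP t. \<bar>a\<bar> * \<bar>fn f t\<bar>) = \<bar>a\<bar> * (SUP t. \<bar>fn f t\<bar>)"
    by (rule trans[OF _ continuous_at_Sup_mono[symmetric]])
      (auto intro!: monoI mult_left_mono continuous_intros bdd simp: image_comp)
  then show "norm (a *\<^sub>R f) = \<bar>a\<bar> * norm f"
    by (simp add: norm_linf_def abs_mult)
qed (auto simp: dist_linf_def sgn_linf_def uniformity_linf_def open_linf_def)
end

lemma norm_linf_SUP: "norm f = (SUP t. \<bar>fn f t\<bar>)"
  by (simp add: norm_linf_def)

definition restr01 :: "(real \<Rightarrow> real) \<Rightarrow> linf" where
  "restr01 g = Linf (\<lambda>s. if s \<in> {0..1} then g s else 0)"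

definition Psi :: "(real \<times> real \<times> real) set" where
  "Psi = {(s,t,u). 0 \<le> s \<and> s \<le> 1 \<and> 0 \<le> t \<and> t \<le> 1}"
definition Psi1 :: "(real \<times> real \<times> real) set" where
  "Psi1 = {(s,t,u). 0 \<le> t \<and> t \<le> s \<and> s \<le> 1}"
definition Psi2 :: "(real \<times> real \<times> real) set" where
  "Psi2 = {(s,t,u). 0 \<le> s \<and> s \<le> t \<and> t \<le> 1}"

text \<open>g is of class C^2 on the (closed, convex, with nonempty interior) set S:
  twice (Frechet) differentiable relative to S with continuous second derivative.\<close>
definition C2_on :: "(real \<times> real \<times> real) set \<Rightarrow> (real \<times> real \<times> real \<Rightarrow> real) \<Rightarrow> bool" where
  "C2_on S g \<longleftrightarrow> (\<exists>Dg D2g.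
      (\<forall>x\<in>S. (g has_derivative blinfun_apply (Dg x)) (at x within S)) \<and>
      (\<forall>x\<in>S. (Dg has_derivative blinfun_apply (D2g x)) (at x within S)) \<and>
      continuous_on S D2g)"

definition kernel_G2_2_0 :: "(real \<Rightarrow> real \<Rightarrow> real \<Rightarrow> real) \<Rightarrow> bool" where
  "kernel_G2_2_0 \<kappa> \<longleftrightarrow> (\<exists>l lu.
     \<comment> \<open>(1) l = d\<kappa>/du exists and is continuous on Psi\<close>
     (\<forall>(s,t,u)\<in>Psi. ((\<lambda>v. \<kappa> s t v) has_real_derivative l s t u) (at u)) \<and>
     continuous_on Psi (\<lambda>(s,t,u). l s t u) \<and>
     \<comment> \<open>(2) l agrees on Psi_i with a C^2 function l_i\<close>
     (\<exists>l1. C2_on Psi1 l1 \<and> (\<forall>(s,t,u)\<in>Psi1. l s t u = l1 (s,t,u))) \<and>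
     (\<exists>l2. C2_on Psi2 l2 \<and> (\<forall>(s,t,u)\<in>Psi2. l s t u = l2 (s,t,u))) \<and>
     \<comment> \<open>(3) \<kappa> agrees on Psi_i with a C^2 function \<kappa>_i\<close>
     (\<exists>\<kappa>1. C2_on Psi1 \<kappa>1 \<and> (\<forall>(s,t,u)\<in>Psi1. \<kappa> s t u = \<kappa>1 (s,t,u))) \<and>
     (\<exists>\<kappa>2. C2_on Psi2 \<kappa>2 \<and> (\<forall>(s,t,u)\<in>Psi2. \<kappa> s t u = \<kappa>2 (s,t,u))) \<and>
     \<comment> \<open>(4) d^2\<kappa>/du^2 exists and is continuous on Psi\<close>
     (\<forall>(s,t,u)\<in>Psi. ((\<lambda>v. l s t v) has_real_derivative lu s t u) (at u)) \<and>
     continuous_on Psi (\<lambda>(s,t,u). lu s t u))"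

definition C2_01 :: "(real \<Rightarrow> real) \<Rightarrow> bool" where
  "C2_01 f \<longleftrightarrow> (\<exists>f' f''.
     (\<forall>t\<in>{0..1}. (f has_real_derivative f' t) (at t within {0..1})) \<and>
     (\<forall>t\<in>{0..1}. (f' has_real_derivative f'' t) (at t within {0..1})) \<and>
     continuous_on {0..1} f'')"

definition Kop :: "(real \<Rightarrow> real \<Rightarrow> real \<Rightarrow> real) \<Rightarrow> linf \<Rightarrow> linf" where
  "Kop \<kappa> x = restr01 (\<lambda>s. integral {0..1} (\<lambda>t. \<kappa> s t (fn x t)))"

definition twice_frechet_differentiable :: "(linf \<Rightarrow> linf) \<Rightarrow> bool" where
  "twice_frechet_differentiable F \<longleftrightarrow>
     (\<forall>x. F differentiable (at x)) \<and>
     (\<forall>x. (\<lambda>y. Blinfun (frechet_derivative F (at y))) differentiable (at x))"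

definition gauss_mu :: "nat \<Rightarrow> real" where
  "gauss_mu q = (if q = 1 then 1/2 - 1 / (2 * sqrt 3) else 1/2 + 1 / (2 * sqrt 3))"
definition gauss_w :: "nat \<Rightarrow> real" where
  "gauss_w q = 1/2"

definition zeta :: "nat \<Rightarrow> nat \<Rightarrow> nat \<Rightarrow> real" where
  "zeta m i q = (real i - 1) / real m + gauss_mu q / real m"

definition Knys :: "(real \<Rightarrow> real \<Rightarrow> real \<Rightarrow> real) \<Rightarrow> nat \<Rightarrow> linf \<Rightarrow> linf" where
  "Knys \<kappa> m x = restr01 (\<lambda>s. (1 / real m) *
      (\<Sum>i=1..m. \<Sum>q\<in>{1,2}. gauss_w q * \<kappa> s (zeta m i q) (fn x (zeta m i q))))"

definition piece :: "nat \<Rightarrow> nat \<Rightarrow> real set" where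
  "piece n j = (if j = 1 then {0 .. 1 / real n} else {(real j - 1) / real n <.. real j / real n})"

definition pidx :: "nat \<Rightarrow> real \<Rightarrow> nat" where
  "pidx n t = (if t = 0 then 1 else nat \<lceil>t * real n\<rceil>)"

definition Xn :: "nat \<Rightarrow> linf set" where
  "Xn n = {x. \<exists>c. \<forall>j\<in>{1..n}. \<forall>t\<in>piece n j. fn x t = c j}"

definition Qform :: "nat \<Rightarrow> nat \<Rightarrow> (real \<Rightarrow> real) \<Rightarrow> real \<Rightarrow> real" where
  "Qform n p v t = (1 / real p) *
     (\<Sum>\<nu>=1..p. \<Sum>q\<in>{1,2}. gauss_w q * v (zeta (n * p) ((pidx n t - 1) * p + \<nu>) q))"

text \<open>Q is a bounded (linear) projection of the space onto X_n extending the formula on C[0,1]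
  (any such extension, e.g. the Hahn--Banach one).\<close>
definition disc_proj :: "nat \<Rightarrow> nat \<Rightarrow> (linf \<Rightarrow>\<^sub>L linf) \<Rightarrow> bool" where
  "disc_proj n p Q \<longleftrightarrow>
     (\<forall>x. blinfun_apply Q x \<in> Xn n) \<and>
     (\<forall>x\<in>Xn n. blinfun_apply Q x = x) \<and>
     (\<forall>x. continuous_on {0..1} (fn x) \<longrightarrow>
          (\<forall>t\<in>{0..1}. fn (blinfun_apply Q x) t = Qform n p (fn x) t))"

definition Ktil :: "(real \<Rightarrow> real \<Rightarrow> real \<Rightarrow> real) \<Rightarrow> nat \<Rightarrow> nat \<Rightarrow> (linf \<Rightarrow>\<^sub>L linf) \<Rightarrow> linf \<Rightarrow> linf" where
  "Ktil \<kappa> n p Q x = blinfun_apply Q (Knys \<kappa> (n * p) x) + Knys \<kappa> (n * p) (blinfun_apply Q x)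
                     - blinfun_apply Q (Knys \<kappa> (n * p) (blinfun_apply Q x))"

end

theory Submission
  imports Defs "HOL-Complex_Analysis.Great_Picard"
begin

text \<open>
  Compactness replaces inverse operators. If the estimate failed, there would be \<open>n \<rightarrow> \<infinity>\<close> and arbitrary
  \<open>p\<close> whose error exceeds any multiple of the claimed order. The Nystroem images of the discrete solutions
  are equi-Lipschitz, so by Arzela--Ascoli a subsequence converges uniformly to a solution of the
  integral equation, hence to \<open>\<phi>\<close>. The errors divided by their norms also subconverge uniformly, and
  since the consistency error at \<open>\<phi>\<close> is of the claimed order, the limit is a fixed point of \<open>K'(\<phi>)\<close>
  of norm one, contradicting that 1 is not an eigenvalue.

  The consistency error splits as \<open>(K\<^sub>m \<phi> - K \<phi>) - (I - Q\<^sub>n)(K\<^sub>m \<phi> - K\<^sub>m Q\<^sub>n \<phi>)\<close>. The first part is a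
  quadrature error for an integrand with a kink on the diagonal, of order \<open>(1/m)\<^sup>2\<close>. In the second part,
  \<open>\<phi> - Q\<^sub>n \<phi>\<close> has mean zero on every cell and \<open>I - Q\<^sub>n\<close> measures oscillation over a cell; each of
  the three mechanisms (size of \<open>\<phi> - Q\<^sub>n \<phi>\<close>, mean zero, oscillation) contributes a factor \<open>1/n\<close>.
\<close>

section \<open>The composite Gauss rule and cell averages\<close>

text \<open>The discrete solutions need not be continuous, because the operator adds a piecewise
  constant part. Compactness is therefore applied to their Nystroem images, which inherit a
  Lipschitz constant from the kernel; what remains is O(1/n), whatever p is. The negated claim
  leaves p free, so every constant has to be uniform in p, and n \<rightarrow> \<infinity> alone
  forces m = np \<rightarrow> \<infinity>.

  The kernel is C^2 only on each side of the diagonal. Once its bounds are extracted, second-order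
  smoothness enters only through difference estimates: across the diagonal the Lipschitz bounds
  survive, on one side the second and mixed differences are available. The same kind of estimate
  describes f, \<phi> and the integrand, so no derivative of a composite function is ever formed.

  A rescaled error could lose its norm in a weak limit; uniform convergence is what keeps the limit
  nonzero.\<close>

definition quad :: "nat \<Rightarrow> (real \<Rightarrow> real) \<Rightarrow> real" where
  "quad m g = (1 / real m) * (\<Sum>i=1..m. \<Sum>q\<in>{1,2}. gauss_w q * g (zeta m i q))"

definition cell_avg :: "nat \<Rightarrow> nat \<Rightarrow> nat \<Rightarrow> (real \<Rightarrow> real) \<Rightarrow> real" where
  "cell_avg n p j v = (1 / real p) *
     (\<Sum>\<nu>=1..p. \<Sum>q\<in>{1,2}. gauss_w q * v (zeta (n * p) ((j - 1) * p + \<nu>) q))"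

lemma Qform_cell_avg: "Qform n p v t = cell_avg n p (pidx n t) v"
  by (simp add: Qform_def cell_avg_def)

lemma gauss_mu_1: "gauss_mu 1 = 1/2 - 1 / (2 * sqrt 3)"
  and gauss_mu_2: "gauss_mu 2 = 1/2 + 1 / (2 * sqrt 3)"
  by (auto simp: gauss_mu_def)

lemma gauss_mu_bounds: "0 < gauss_mu q" "gauss_mu q < 1"
proof -
  have "1 < sqrt 3" by simp
  then have "1 / (2 * sqrt 3) < 1/2" "0 < 1 / (2 * sqrt 3)" by (simp_all add: field_simps)
  then show "0 < gauss_mu q" "gauss_mu q < 1"
    unfolding gauss_mu_def by (auto split: if_splits; linarith)+
qed

lemma zeta_bounds:
  assumes "m \<ge> 1"
  shows "(real i - 1) / real m < zeta m i q" "zeta m i q < real i / real m"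
  using assms gauss_mu_bounds[of q] by (auto simp: zeta_def field_simps)

lemma zeta_in_unit:
  assumes "i \<in> {1..m}"
  shows "zeta m i q \<in> {0..1}"
proof -
  have m: "m \<ge> 1" using assms by auto
  have "0 \<le> (real i - 1) / real m" "real i / real m \<le> 1" using assms by auto
  then show ?thesis using zeta_bounds[OF m, of i q] by auto
qed

text \<open>With all nodes in the open cell, an average over cell j sees only values belonging to
  that cell, whichever endpoints \<open>piece\<close> and \<open>pidx\<close> assign to it.\<close>

lemma zeta_cell_bounds:
  assumes "n \<ge> 1" "p \<ge> 1" "j \<ge> 1" "\<nu> \<in> {1..p}"
  shows "(real j - 1) / real n < zeta (n*p) ((j-1)*p+\<nu>) q"
    and "zeta (n*p) ((j-1)*p+\<nu>) q < real j / real n"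
proof -
  have np: "n * p \<ge> 1" using assms by simp
  have r: "real ((j-1)*p+\<nu>) = (real j - 1) * real p + real \<nu>" using assms by (simp add: of_nat_diff)
  have "(real j - 1) / real n \<le> ((real j - 1) * real p + real \<nu> - 1) / real (n*p)"
    using assms by (simp add: field_simps)
  then show "(real j - 1) / real n < zeta (n*p) ((j-1)*p+\<nu>) q"
    using zeta_bounds(1)[OF np, of "(j-1)*p+\<nu>" q] unfolding r by linarith
  have "(real j - 1) * real p + real \<nu> \<le> real j * real p"
    using assms by (simp add: algebra_simps)
  then have "((real j - 1) * real p + real \<nu>) / real (n*p) \<le> real j * real p / real (n*p)"
    by (rule divide_right_mono) simp
  also have "\<dots> = real j / real n" using assms by (simp add: field_simps)
  finally show "zeta (n*p) ((j-1)*p+\<nu>) q < real j / real n"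
    using zeta_bounds(2)[OF np, of "(j-1)*p+\<nu>" q] unfolding r by linarith
qed

lemma pidx_eqI:
  assumes "n \<ge> 1" "j \<ge> 1" "(real j - 1) / real n < t" "t \<le> real j / real n"
  shows "pidx n t = j"
proof -
  \<comment> \<open>Positivity rules out the separate clause of \<open>pidx\<close> at 0.\<close>
  have t0: "t > 0" using assms(1,2,3) by (smt (verit) divide_nonneg_nonneg of_nat_0_le_iff of_nat_1 of_nat_mono)
  have "\<lceil>t * real n\<rceil> = int j"
    using assms by (intro ceiling_unique) (auto simp: field_simps)
  then show ?thesis using t0 by (simp add: pidx_def)
qed

lemma pidx_in_cell:
  assumes "n \<ge> 1" "t \<in> {0..1}"
  shows "pidx n t \<in> {1..n}" "t \<in> piece n (pidx n t)"
    "(real (pidx n t) - 1) / real n \<le> t" "t \<le> real (pidx n t) / real n"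
proof -
  have "pidx n t \<in> {1..n} \<and> t \<in> piece n (pidx n t) \<and> (real (pidx n t) - 1) / real n \<le> t
      \<and> t \<le> real (pidx n t) / real n"
  proof (cases "t = 0")
    case True
    then show ?thesis using assms by (simp add: pidx_def piece_def)
  next
    case False
    then have t: "t > 0" "t * real n > 0" using assms by auto
    have c: "real (pidx n t) = of_int \<lceil>t * real n\<rceil>"
      using False t by (simp add: pidx_def)
    have lo: "real (pidx n t) - 1 < t * real n" and hi: "t * real n \<le> real (pidx n t)"
      unfolding c by linarith+
    have "t * real n \<le> real n" using assms by (simp add: mult_left_le_one_le)
    then have "real (pidx n t) < real n + 1" using lo by linarith
    then have 1: "pidx n t \<le> n" by linarith
    have 2: "pidx n t \<ge> 1" using hi t by (cases "pidx n t") auto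
    have "(real (pidx n t) - 1) / real n < t" "t \<le> real (pidx n t) / real n"
      using lo hi assms by (auto simp: field_simps)
    then show ?thesis using 1 2 t by (auto simp: piece_def)
  qed
  then show "pidx n t \<in> {1..n}" "t \<in> piece n (pidx n t)"
    "(real (pidx n t) - 1) / real n \<le> t" "t \<le> real (pidx n t) / real n" by auto
qed

section \<open>Linearity and sup bounds of the rule and of cell averages\<close>

lemma quad_diff: "quad m (\<lambda>t. g t - h t) = quad m g - quad m h"
  by (simp add: quad_def sum_subtractf right_diff_distrib sum.distrib algebra_simps)

lemma quad_cmult: "quad m (\<lambda>t. c * g t) = c * quad m g"
  by (simp add: quad_def sum_distrib_left sum.distrib algebra_simps)

lemma quad_divide: "quad m (\<lambda>t. g t / c) = quad m g / c"
  using quad_cmult[of m "1/c" g] by (simp add: field_simps)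

lemma quad_bound:
  assumes "m \<ge> 1" "\<And>t. t \<in> {0..1} \<Longrightarrow> \<bar>g t\<bar> \<le> B"
  shows "\<bar>quad m g\<bar> \<le> B"
proof -
  have "\<bar>\<Sum>i=1..m. \<Sum>q\<in>{1,2}. gauss_w q * g (zeta m i q)\<bar> \<le> (\<Sum>i=1..m. B)"
  proof (rule order_trans[OF sum_abs], rule sum_mono)
    fix i assume "i \<in> {1..m}"
    then have "\<bar>g (zeta m i q)\<bar> \<le> B" for q by (intro assms zeta_in_unit)
    from this[of 1] this[of 2] show "\<bar>\<Sum>q\<in>{1,2}. gauss_w q * g (zeta m i q)\<bar> \<le> B"
      by (simp add: gauss_w_def abs_le_iff)
  qed
  then show ?thesis using assms(1) by (simp add: quad_def abs_mult field_simps)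
qed

lemma cell_avg_diff: "cell_avg n p j (\<lambda>t. g t - h t) = cell_avg n p j g - cell_avg n p j h"
  by (simp add: cell_avg_def sum_subtractf right_diff_distrib sum.distrib algebra_simps)

lemma cell_avg_add: "cell_avg n p j (\<lambda>t. g t + h t) = cell_avg n p j g + cell_avg n p j h"
  by (simp add: cell_avg_def right_diff_distrib sum.distrib algebra_simps)

lemma cell_avg_cmult: "cell_avg n p j (\<lambda>t. c * g t) = c * cell_avg n p j g"
  by (simp add: cell_avg_def sum_distrib_left sum.distrib algebra_simps)

lemma cell_avg_cong:
  assumes "n \<ge> 1" "p \<ge> 1" "j \<ge> 1"
    "\<And>t. (real j - 1) / real n < t \<Longrightarrow> t < real j / real n \<Longrightarrow> g t = h t"
  shows "cell_avg n p j g = cell_avg n p j h"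
  unfolding cell_avg_def
  by (intro arg_cong2[where f="(*)"] sum.cong refl assms(4) zeta_cell_bounds assms(1-3))

lemma cell_avg_const: "p \<ge> 1 \<Longrightarrow> cell_avg n p j (\<lambda>_. c) = c"
  by (simp add: cell_avg_def gauss_w_def)

lemma cell_avg_bound:
  assumes "n \<ge> 1" "p \<ge> 1" "j \<ge> 1"
    "\<And>t. (real j - 1) / real n < t \<Longrightarrow> t < real j / real n \<Longrightarrow> \<bar>g t\<bar> \<le> B"
  shows "\<bar>cell_avg n p j g\<bar> \<le> B"
proof -
  have "\<bar>\<Sum>\<nu>=1..p. \<Sum>q\<in>{1,2}. gauss_w q * g (zeta (n * p) ((j - 1) * p + \<nu>) q)\<bar> \<le> (\<Sum>i=1..p. B)"
  proof (rule order_trans[OF sum_abs], rule sum_mono)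
    fix i assume "i \<in> {1..p}"
    then have "\<bar>g (zeta (n * p) ((j - 1) * p + i) q)\<bar> \<le> B" for q
      by (intro assms(4) zeta_cell_bounds assms)
    from this[of 1] this[of 2]
    show "\<bar>\<Sum>q\<in>{1,2}. gauss_w q * g (zeta (n * p) ((j - 1) * p + i) q)\<bar> \<le> B"
      by (simp add: gauss_w_def abs_le_iff)
  qed
  then show ?thesis using assms(2) by (simp add: cell_avg_def abs_mult field_simps)
qed

lemma sum_blocks:
  fixes F :: "nat \<Rightarrow> real"
  shows "(\<Sum>i=1..n*p. F i) = (\<Sum>j=1..n. \<Sum>\<nu>=1..p. F ((j-1)*p+\<nu>))"
proof (induction n)
  case (Suc n)
  have "(\<Sum>i=1..Suc n*p. F i) = (\<Sum>i=1..n*p. F i) + (\<Sum>i=n*p+1..n*p+p. F i)"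
    by (subst sum.ub_add_nat[symmetric]) (auto simp: add.commute)
  also have "(\<Sum>i=n*p+1..n*p+p. F i) = (\<Sum>\<nu>=1..p. F (n*p+\<nu>))"
    using sum.shift_bounds_cl_nat_ivl[of F 1 "n*p" p] by (simp add: add.commute)
  finally show ?case using Suc by simp
qed simp

text \<open>Quadrature and projection share their nodes, so a factor with zero average over a cell
  is annihilated exactly by the rule there, with no quadrature error. The cubic order in 1/n rests
  on this.\<close>

lemma quad_eq_cells:
  assumes "p \<ge> 1"
  shows "quad (n*p) g = (\<Sum>j=1..n. cell_avg n p j g) / real n"
  using assms unfolding quad_def cell_avg_def sum_blocks[of _ n p]
  by (simp add: sum_divide_distrib[symmetric] mult.commute)

section \<open>Quadrature error on one panel and on the unit interval\<close>

lemma gauss_interval_rough: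
  fixes g :: "real \<Rightarrow> real"
  assumes g: "continuous_on {a..b} g" and d: "b = a + d" "d > 0"
    and osc: "\<And>t t'. t \<in> {a..b} \<Longrightarrow> t' \<in> {a..b} \<Longrightarrow> \<bar>g t - g t'\<bar> \<le> B"
    and x: "x \<in> {a..b}" "y \<in> {a..b}"
  shows "\<bar>integral {a..b} g - d * ((g x + g y) / 2)\<bar> \<le> d * B"
proof -
  let ?c = "(g x + g y) / 2"
  have int: "g integrable_on {a..b}" using g by (rule integrable_continuous_real)
  have "integral {a..b} g - d * ?c = integral {a..b} (\<lambda>t. g t - ?c)"
    using d int integral_const_real[of ?c a b] by (subst integral_diff) auto
  moreover have "norm (integral {a..b} (\<lambda>t. g t - ?c)) \<le> integral {a..b} (\<lambda>t. B)"
  proof (rule integral_norm_bound_integral)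
    fix t assume "t \<in> {a..b}"
    then show "norm (g t - ?c) \<le> B" using osc[of t x] osc[of t y] x by (auto simp: abs_le_iff field_simps)
  qed (use int in \<open>auto intro!: integrable_diff\<close>)
  ultimately show ?thesis using d by simp
qed

text \<open>The nodes are symmetric about the midpoint, so both the integral and the rule only see
  symmetric second differences there; no derivatives of the integrand are needed.\<close>

lemma gauss_interval_smooth:
  fixes g :: "real \<Rightarrow> real"
  assumes g: "continuous_on {a..b} g" and d: "b = a + d" "d > 0" and M: "M \<ge> 0"
    and sd: "\<And>t h. t - h \<in> {a..b} \<Longrightarrow> t + h \<in> {a..b} \<Longrightarrow> \<bar>g (t + h) - 2 * g t + g (t - h)\<bar> \<le> M * h^2"
    and x: "x = a + d/2 - e" "y = a + d/2 + e" "\<bar>e\<bar> \<le> d/2"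
  shows "\<bar>integral {a..b} g - d * ((g x + g y) / 2)\<bar> \<le> d * (M * d^2)"
proof -
  define c where "c = a + d/2"
  have int: "g integrable_on {a..b}" using g by (rule integrable_continuous_real)
  have i1: "(g has_integral integral {a..b} g) {a..b}" using int by (rule integrable_integral)
  \<comment> \<open>The reflection t \<mapsto> 2c - t maps the interval onto itself, so adding the
    reflected integrand doubles the integral and produces the symmetric second difference at the
    midpoint c.\<close>
  have "((\<lambda>t. g (-1 *\<^sub>R t + 2 * c)) has_integral (1 / (\<bar>-1\<bar> ^ DIM(real))) *\<^sub>R integral {a..b} g)
        ((\<lambda>x. (1 / (-1)) *\<^sub>R x + -((1 / (-1)) *\<^sub>R (2 * c))) ` cbox a b)"
    using i1 by (intro has_integral_affinity) auto
  moreover have "2 * c - b = a" "2 * c - a = b" using d by (auto simp: c_def)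
  ultimately have i2: "((\<lambda>t. g (2 * c - t)) has_integral integral {a..b} g) {a..b}" using d by simp
  have i3: "((\<lambda>t. g t - 2 * g c + g (2 * c - t)) has_integral
      (integral {a..b} g - d * (2 * g c) + integral {a..b} g)) {a..b}"
    using has_integral_const_real[of "2 * g c" a b] d
    by (intro has_integral_add has_integral_diff i1 i2) auto
  have "norm (integral {a..b} g - d * (2 * g c) + integral {a..b} g) \<le> (M * d^2) * measure lborel (cbox a b)"
  proof (rule has_integral_bound)
    show "((\<lambda>t. g t - 2 * g c + g (2 * c - t)) has_integral
      (integral {a..b} g - d * (2 * g c) + integral {a..b} g)) (cbox a b)" using i3 by simp
    fix t assume t: "t \<in> cbox a b"
    have "\<bar>g (c + (t - c)) - 2 * g c + g (c - (t - c))\<bar> \<le> M * (t - c)^2"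
      by (rule sd) (use t d in \<open>auto simp: c_def\<close>)
    also have "M * (t - c)^2 \<le> M * d^2"
      using t d M by (intro mult_left_mono abs_le_square_iff[THEN iffD1]) (auto simp: c_def)
    finally show "norm (g t - 2 * g c + g (2 * c - t)) \<le> M * d^2" by simp
  qed (use M in auto)
  then have "\<bar>2 * integral {a..b} g - 2 * (d * g c)\<bar> \<le> d * (M * d^2)"
    using d by (simp add: algebra_simps)
  \<comment> \<open>The integral and the rule are each compared with d times the midpoint value;
    each comparison costs half of the final bound.\<close>
  then have 1: "\<bar>integral {a..b} g - d * g c\<bar> \<le> d * (M * d^2) / 2" by linarith
  have "\<bar>g (c + e) - 2 * g c + g (c - e)\<bar> \<le> M * e^2"
    by (rule sd) (use x d in \<open>auto simp: c_def\<close>)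
  also have "M * e^2 \<le> M * d^2" using x d M by (intro mult_left_mono abs_le_square_iff[THEN iffD1]) auto
  finally have "\<bar>g x + g y - 2 * g c\<bar> \<le> M * d^2" by (simp add: x c_def algebra_simps)
  then have "d * \<bar>(g x + g y)/2 - g c\<bar> \<le> d * (M * d^2 / 2)"
    using d by (intro mult_left_mono) (auto simp: abs_le_iff field_simps)
  then have 2: "\<bar>d * ((g x + g y)/2) - d * g c\<bar> \<le> d * (M * d^2) / 2"
    using d by (simp only: right_diff_distrib[symmetric] abs_mult)
  show ?thesis using 1 2 by linarith
qed

lemma integral_subdivide:
  fixes g :: "real \<Rightarrow> real"
  assumes g: "continuous_on {0..1} g" and "m \<ge> 1" "k \<le> m"
  shows "integral {0..real k / real m} g = (\<Sum>i=1..k. integral {(real i - 1)/real m..real i/real m} g)"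
  using \<open>k \<le> m\<close>
proof (induction k)
  case (Suc k)
  have "integral {0..real (Suc k) / real m} g = integral {0..real k / real m} g
      + integral {real k / real m..real (Suc k) / real m} g"
  proof (rule Henstock_Kurzweil_Integration.integral_combine[symmetric])
    show "g integrable_on {0..real (Suc k) / real m}"
      using Suc.prems by (intro integrable_continuous_real continuous_on_subset[OF g]) auto
  qed (auto intro!: divide_right_mono)
  then show ?case using Suc by simp
qed simp

lemma quad_error_sum:
  assumes g: "continuous_on {0..1} g" and m: "m \<ge> 1"
    and b: "\<And>i. i \<in> {1..m} \<Longrightarrow> \<bar>integral {(real i - 1)/real m..real i/real m} g
        - 1/real m * ((g (zeta m i 1) + g (zeta m i 2)) / 2)\<bar> \<le> B i"
  shows "\<bar>integral {0..1} g - quad m g\<bar> \<le> (\<Sum>i=1..m. B i)"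
proof -
  have "integral {0..1} g - quad m g = (\<Sum>i=1..m. integral {(real i - 1)/real m..real i/real m} g
        - 1/real m * ((g (zeta m i 1) + g (zeta m i 2)) / 2))"
    using integral_subdivide[OF g m order_refl] m
    by (simp add: quad_def gauss_w_def sum_subtractf sum_distrib_left add_divide_distrib)
  also have "\<bar>\<dots>\<bar> \<le> (\<Sum>i=1..m. B i)" by (rule order_trans[OF sum_abs sum_mono[OF b]])
  finally show ?thesis .
qed

lemma subinterval_unit:
  assumes "i \<in> {1..m}"
  shows "{(real i - 1)/real m..real i/real m} \<subseteq> {0..1}"
proof -
  have "0 \<le> (real i - 1) / real m" "real i / real m \<le> 1" using assms by auto
  then show ?thesis by auto
qed

text \<open>The limit functions of the compactness argument are only known to be continuous, so
  convergence without a rate is what is needed; it follows from uniform continuity.\<close>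

lemma quad_tendsto_integral:
  assumes g: "continuous_on {0..1} g"
  shows "(\<lambda>m. quad m g) \<longlonglongrightarrow> integral {0..1} g"
proof (rule LIMSEQ_I)
  fix e :: real assume e: "e > 0"
  have "uniformly_continuous_on {0..1} g" using g by (intro compact_uniformly_continuous) auto
  then obtain d where d: "d > 0" "\<And>x x'. x \<in> {0..1} \<Longrightarrow> x' \<in> {0..1} \<Longrightarrow> dist x' x < d \<Longrightarrow> dist (g x') (g x) < e/2"
    using e unfolding uniformly_continuous_on_def by (metis half_gt_zero)
  obtain N where N: "1/d < real N" using reals_Archimedean2 by blast
  show "\<exists>no. \<forall>n\<ge>no. norm (quad n g - integral {0..1} g) < e"
  proof (intro exI allI impI)
    fix m assume m: "m \<ge> Suc N"
    then have m1: "m \<ge> 1" by simp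
    have "1/d < real m" using N m by linarith
    then have md: "1 / real m < d" using d m1 by (simp add: field_simps)
    have "\<bar>integral {0..1} g - quad m g\<bar> \<le> (\<Sum>i=1..m. 1/real m * (e/2))"
    proof (rule quad_error_sum[OF g m1])
      fix i assume i: "i \<in> {1..m}"
      note sub = subinterval_unit[OF i]
      show "\<bar>integral {(real i - 1)/real m..real i/real m} g
        - 1/real m * ((g (zeta m i 1) + g (zeta m i 2)) / 2)\<bar> \<le> 1/real m * (e/2)"
      proof (rule gauss_interval_rough)
        show "continuous_on {(real i - 1)/real m..real i/real m} g" using g sub by (rule continuous_on_subset)
        show "real i / real m = (real i - 1) / real m + 1/real m" by (simp add: diff_divide_distrib)
        fix t t' assume t: "t \<in> {(real i - 1)/real m..real i/real m}" "t' \<in> {(real i - 1)/real m..real i/real m}"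
        then have "\<bar>t - t'\<bar> \<le> 1 / real m" by (auto simp: diff_divide_distrib abs_le_iff)
        then show "\<bar>g t - g t'\<bar> \<le> e/2" using d(2)[of t' t] t sub md by (auto simp: dist_real_def)
      qed (use m1 zeta_bounds[OF m1, of i] in \<open>auto intro: less_imp_le\<close>)
    qed
    also have "\<dots> = e/2" using m1 by simp
    finally show "norm (quad m g - integral {0..1} g) < e" using e by (simp add: abs_minus_commute)
  qed
qed

text \<open>A kink at an interior point \<open>s\<close> spoils only the one subinterval that contains it,
  where the Lipschitz bound costs no more than the total of the others.\<close>

lemma quad_error_kink:
  assumes m: "m \<ge> 1" and M: "M \<ge> 0"
    and lip: "\<And>t t'. t \<in> {0..1} \<Longrightarrow> t' \<in> {0..1} \<Longrightarrow> \<bar>g t - g t'\<bar> \<le> M * \<bar>t - t'\<bar>"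
    and sd1: "\<And>t h. t - h \<in> {0..s} \<Longrightarrow> t + h \<in> {0..s} \<Longrightarrow> \<bar>g (t + h) - 2 * g t + g (t - h)\<bar> \<le> M * h^2"
    and sd2: "\<And>t h. t - h \<in> {s..1} \<Longrightarrow> t + h \<in> {s..1} \<Longrightarrow> \<bar>g (t + h) - 2 * g t + g (t - h)\<bar> \<le> M * h^2"
  shows "\<bar>integral {0..1} g - quad m g\<bar> \<le> 2 * M * (1 / real m)^2"
proof -
  let ?d = "1 / real m"
  have "M-lipschitz_on {0..1} g" using lip M by (auto intro!: lipschitz_onI simp: dist_real_def)
  then have g: "continuous_on {0..1} g" by (rule lipschitz_on_continuous_on)
  \<comment> \<open>Only a panel with s in its open interior is bad: if s is an endpoint, the panel
    lies on one side of the kink.\<close>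
  define K where "K = {i \<in> {1..m}. (real i - 1)/real m < s \<and> s < real i/real m}"
  have cK: "card K \<le> 1"
  proof -
    have "i = j" if "i \<in> K" "j \<in> K" for i j
    proof -
      have "real i - 1 < s * real m" "s * real m < real i" "real j - 1 < s * real m" "s * real m < real j"
        using that m by (auto simp: K_def field_simps)
      then show ?thesis by linarith
    qed
    then have "is_singleton K \<or> K = {}" unfolding is_singleton_def by blast
    then show ?thesis by (auto simp: is_singleton_def)
  qed
  have "\<bar>integral {0..1} g - quad m g\<bar> \<le> (\<Sum>i=1..m. ?d * (M * ?d^2) + (if i \<in> K then ?d * (M * ?d) else 0))"
  proof (rule quad_error_sum[OF g m])
    fix i assume i: "i \<in> {1..m}"
    let ?a = "(real i - 1)/real m" and ?b = "real i/real m"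
    note sub = subinterval_unit[OF i]
    have ab: "?b = ?a + ?d" by (simp add: diff_divide_distrib)
    have cont: "continuous_on {?a..?b} g" using g sub by (rule continuous_on_subset)
    have pos: "?d > 0" using m by simp
    show "\<bar>integral {?a..?b} g - ?d * ((g (zeta m i 1) + g (zeta m i 2)) / 2)\<bar>
        \<le> ?d * (M * ?d^2) + (if i \<in> K then ?d * (M * ?d) else 0)"
    proof (cases "i \<in> K")
      case True
      have "\<bar>integral {?a..?b} g - ?d * ((g (zeta m i 1) + g (zeta m i 2)) / 2)\<bar> \<le> ?d * (M * ?d)"
      proof (rule gauss_interval_rough[OF cont ab pos])
        fix t t' assume t: "t \<in> {?a..?b}" "t' \<in> {?a..?b}"
        then have "\<bar>t - t'\<bar> \<le> ?d" using ab by (auto simp: abs_le_iff)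
        then have "M * \<bar>t - t'\<bar> \<le> M * ?d" using M by (rule mult_left_mono)
        then show "\<bar>g t - g t'\<bar> \<le> M * ?d" using lip[of t t'] t sub by auto
      qed (use zeta_bounds[OF m, of i] in \<open>auto intro: less_imp_le\<close>)
      moreover have "0 \<le> ?d * (M * ?d^2)" using M by simp
      ultimately show ?thesis using True by simp
    next
      case False
      then have side: "s \<le> ?a \<or> ?b \<le> s" using i unfolding K_def by auto
      define e where "e = ?d / (2 * sqrt 3)"
      have "1 < sqrt 3" by simp
      then have e: "0 \<le> e" "e \<le> ?d / 2" unfolding e_def using pos by (auto intro!: divide_left_mono)
      have "\<bar>integral {?a..?b} g - ?d * ((g (zeta m i 1) + g (zeta m i 2)) / 2)\<bar> \<le> ?d * (M * ?d^2)"
      proof (rule gauss_interval_smooth[OF cont ab pos M])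
        fix t h assume th: "t - h \<in> {?a..?b}" "t + h \<in> {?a..?b}"
        from side show "\<bar>g (t + h) - 2 * g t + g (t - h)\<bar> \<le> M * h^2"
        proof
          assume "s \<le> ?a" then show ?thesis using th sub by (intro sd2) auto
        next
          assume "?b \<le> s" then show ?thesis using th sub by (intro sd1) auto
        qed
      next
        show "zeta m i 1 = ?a + ?d/2 - e" unfolding zeta_def e_def gauss_mu_1 by (simp add: diff_divide_distrib add_divide_distrib)
        show "zeta m i 2 = ?a + ?d/2 + e" unfolding zeta_def e_def gauss_mu_2 by (simp add: diff_divide_distrib add_divide_distrib)
        show "\<bar>e\<bar> \<le> ?d/2" using e by simp
      qed
      then show ?thesis using False by simp
    qed
  qed
  also have "\<dots> = M * ?d^2 + real (card K) * (M * ?d^2)"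
  proof -
    have "(\<Sum>i=1..m. (if i \<in> K then ?d * (M * ?d) else 0)) = (\<Sum>i\<in>K. ?d * (M * ?d))"
      by (rule sum.mono_neutral_cong_right) (auto simp: K_def)
    then show ?thesis using m by (simp add: sum.distrib power2_eq_square algebra_simps)
  qed
  also have "\<dots> \<le> M * ?d^2 + 1 * (M * ?d^2)"
    using cK M by (intro add_left_mono mult_right_mono) auto
  finally show ?thesis by simp
qed

section \<open>Local bounds for the kernel\<close>

text \<open>Everything later needed from C^2 regularity, without derivatives. In the second
  difference, y and y' need not be symmetric about x: the points will be (s, t \<plusminus> h, x(t
  \<plusminus> h)) on a curve, and the last norm measures the defect of symmetry. The final clause
  is a mixed difference, small in both displacements.\<close>

definition C2_bounds :: "'a::real_normed_vector set \<Rightarrow> ('a \<Rightarrow> real) \<Rightarrow> real \<Rightarrow> bool" where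
  "C2_bounds T g M \<longleftrightarrow> 0 \<le> M \<and> (\<forall>x\<in>T. \<bar>g x\<bar> \<le> M) \<and>
     (\<forall>x\<in>T. \<forall>y\<in>T. \<bar>g x - g y\<bar> \<le> M * norm (x - y)) \<and>
     (\<forall>x\<in>T. \<forall>y\<in>T. \<forall>y'\<in>T. \<bar>g y - 2 * g x + g y'\<bar>
        \<le> M * (norm (y - x)^2 + norm (y' - x)^2 + norm ((y - x) + (y' - x)))) \<and>
     (\<forall>x y v. x \<in> T \<longrightarrow> y \<in> T \<longrightarrow> x + v \<in> T \<longrightarrow> y + v \<in> T \<longrightarrow>
        \<bar>g (x + v) - g x - g (y + v) + g y\<bar> \<le> M * norm v * norm (x - y))"

lemma C2_bounds_mono:
  assumes "C2_bounds T g M" "M \<le> M'"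
  shows "C2_bounds T g M'"
proof -
  have *: "a \<le> M * b \<Longrightarrow> 0 \<le> b \<Longrightarrow> a \<le> M' * b" for a b
    using mult_right_mono[OF assms(2), of b] by linarith
  have "0 \<le> M'" using assms unfolding C2_bounds_def by linarith
  moreover have "\<forall>x\<in>T. \<bar>g x\<bar> \<le> M'" using assms unfolding C2_bounds_def by force
  ultimately show ?thesis
    using assms(1) unfolding C2_bounds_def
    by (auto simp: mult.assoc intro!: *)
qed

text \<open>Compactness bounds g and its first two derivatives; convexity keeps segments inside T,
  so that the mean value inequality turns these bounds into difference bounds.\<close>

lemma C2_on_bounds:
  fixes T :: "(real \<times> real \<times> real) set"
  assumes C2: "C2_on S g" and T: "T \<subseteq> S" "compact T" "convex T"
  shows "\<exists>M. C2_bounds T g M"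
proof -
  obtain Dg D2g where
    D: "\<And>x. x \<in> S \<Longrightarrow> (g has_derivative blinfun_apply (Dg x)) (at x within S)"
    and D2: "\<And>x. x \<in> S \<Longrightarrow> (Dg has_derivative blinfun_apply (D2g x)) (at x within S)"
    and cont: "continuous_on S D2g"
    using C2 unfolding C2_on_def by blast
  have DT: "(g has_derivative blinfun_apply (Dg x)) (at x within T)" if "x \<in> T" for x
    using has_derivative_subset[OF D T(1)] T(1) that by blast
  have D2T: "(Dg has_derivative blinfun_apply (D2g x)) (at x within T)" if "x \<in> T" for x
    using has_derivative_subset[OF D2 T(1)] T(1) that by blast
  have cg: "continuous_on T g" by (rule has_derivative_continuous_on[OF DT])
  have cDg: "continuous_on T Dg" by (rule has_derivative_continuous_on[OF D2T])
  have cD2g: "continuous_on T D2g" using cont T(1) by (rule continuous_on_subset)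
  obtain B0 where B0: "\<And>x. x \<in> T \<Longrightarrow> norm (g x) \<le> B0"
    using compact_imp_bounded[OF compact_continuous_image[OF cg T(2)]] by (auto simp: bounded_iff)
  obtain B1 where B1: "\<And>x. x \<in> T \<Longrightarrow> norm (Dg x) \<le> B1"
    using compact_imp_bounded[OF compact_continuous_image[OF cDg T(2)]] by (auto simp: bounded_iff)
  obtain B2 where B2: "\<And>x. x \<in> T \<Longrightarrow> norm (D2g x) \<le> B2"
    using compact_imp_bounded[OF compact_continuous_image[OF cD2g T(2)]] by (auto simp: bounded_iff)
  define M where "M = \<bar>B0\<bar> + \<bar>B1\<bar> + \<bar>B2\<bar>"
  have M: "0 \<le> M" by (simp add: M_def)
  have M0: "\<bar>g x\<bar> \<le> M" and M1: "norm (Dg x) \<le> M" and M2: "norm (D2g x) \<le> M" if "x \<in> T" for x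
    using B0[OF that] B1[OF that] B2[OF that] unfolding M_def by auto
  have L0: "\<bar>g x - g y\<bar> \<le> M * norm (x - y)" if "x \<in> T" "y \<in> T" for x y
    using differentiable_bound[OF T(3) DT, of M x y] that M1 by (auto simp: norm_blinfun.rep_eq)
  have L1: "norm (Dg x - Dg y) \<le> M * norm (x - y)" if "x \<in> T" "y \<in> T" for x y
    using differentiable_bound[OF T(3) D2T, of M x y] that M2 by (auto simp: norm_blinfun.rep_eq)
  have taylor: "\<bar>g y - g x - blinfun_apply (Dg x) (y - x)\<bar> \<le> M * norm (y - x)^2"
    if xy: "x \<in> T" "y \<in> T" for x y
  proof -
    have seg: "closed_segment x y \<subseteq> T" using xy T(3) by (simp add: closed_segment_subset)
    have "norm (g y - g x - blinfun_apply (Dg x) (y - x)) \<le> norm (y - x) * (M * norm (y - x))"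
    proof (rule differentiable_bound_linearization[where S="closed_segment x y"])
      fix t :: real assume "t \<in> {0..1}"
      then show "x + t *\<^sub>R (y - x) \<in> closed_segment x y"
        unfolding closed_segment_def by (auto intro!: exI[of _ t] simp: algebra_simps)
    next
      fix w assume w: "w \<in> closed_segment x y"
      show "(g has_derivative blinfun_apply (Dg w)) (at w within closed_segment x y)"
        using has_derivative_subset[OF DT seg] seg w by blast
      have "onorm (blinfun_apply (Dg w) - blinfun_apply (Dg x)) = norm (Dg w - Dg x)"
        by (simp add: norm_blinfun.rep_eq minus_blinfun.rep_eq fun_diff_def)
      also have "\<dots> \<le> M * norm (w - x)" using L1 w seg xy by blast
      also have "\<dots> \<le> M * norm (y - x)"
        using segment_bound(1)[OF w] M by (intro mult_left_mono) (auto simp: norm_minus_commute)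
      finally show "onorm (blinfun_apply (Dg w) - blinfun_apply (Dg x)) \<le> M * norm (y - x)" .
    qed simp
    then show ?thesis by (simp add: power2_eq_square algebra_simps)
  qed
  have second: "\<bar>g y - 2 * g x + g y'\<bar> \<le> M * (norm (y - x)^2 + norm (y' - x)^2 + norm ((y - x) + (y' - x)))"
    if "x \<in> T" "y \<in> T" "y' \<in> T" for x y y'
  proof -
    have "\<bar>blinfun_apply (Dg x) ((y - x) + (y' - x))\<bar> \<le> M * norm ((y - x) + (y' - x))"
      using norm_blinfun[of "Dg x" "(y - x) + (y' - x)"] mult_right_mono[OF M1[OF that(1)], of "norm ((y - x) + (y' - x))"]
      by (simp only: real_norm_def norm_ge_zero True_implies_equals)
    \<comment> \<open>Two Taylor expansions at x. Their linear terms do not cancel for asymmetric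
      points and leave the derivative evaluated at the defect (y - x) + (y' - x).\<close>
    moreover have "g y - 2 * g x + g y' = (g y - g x - blinfun_apply (Dg x) (y - x))
        + (g y' - g x - blinfun_apply (Dg x) (y' - x)) + blinfun_apply (Dg x) ((y - x) + (y' - x))"
      by (subst blinfun.add_right) linarith
    ultimately show ?thesis
      using taylor[OF that(1,2)] taylor[OF that(1,3)] unfolding distrib_left by linarith
  qed
  have mixed: "\<bar>g (x + v) - g x - g (y + v) + g y\<bar> \<le> M * norm v * norm (x - y)"
    if xy: "x \<in> T" "y \<in> T" "x + v \<in> T" "y + v \<in> T" for x y v
  proof -
    let ?U = "{x \<in> T. x + v \<in> T}"
    have cU: "convex ?U"
    proof (rule convexI)
      fix a b and p q :: real assume ab: "a \<in> ?U" "b \<in> ?U" "0 \<le> p" "0 \<le> q" "p + q = 1"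
      have "p *\<^sub>R (a + v) + q *\<^sub>R (b + v) = (p *\<^sub>R a + q *\<^sub>R b) + (p + q) *\<^sub>R v"
        by (simp add: algebra_simps)
      then have "(p *\<^sub>R a + q *\<^sub>R b) + v = p *\<^sub>R (a + v) + q *\<^sub>R (b + v)" using ab(5) by simp
      then show "p *\<^sub>R a + q *\<^sub>R b \<in> ?U"
        using ab convexD[OF T(3), of a b p q] convexD[OF T(3), of "a + v" "b + v" p q] by simp
    qed
    \<comment> \<open>Mean value inequality for the increment x \<mapsto> g(x + v) - g(x), whose
      derivative has norm at most M times that of v because \<open>Dg\<close> is Lipschitz.\<close>
    have "norm ((g (x + v) - g x) - (g (y + v) - g y)) \<le> (M * norm v) * norm (x - y)"
    proof (rule differentiable_bound[OF cU])
      fix w assume w: "w \<in> ?U"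
      have 1: "((\<lambda>x. g (x + v)) has_derivative (\<lambda>h. blinfun_apply (Dg (w + v)) h)) (at w within ?U)"
      proof (rule has_derivative_in_compose2[of T g "\<lambda>x. blinfun_apply (Dg x)" "\<lambda>x. x + v"])
        show "((\<lambda>x. x + v) has_derivative (\<lambda>h. h)) (at w within ?U)"
          by (auto intro!: derivative_eq_intros)
      qed (use w DT in auto)
      have 2: "(g has_derivative blinfun_apply (Dg w)) (at w within ?U)"
        using has_derivative_subset[OF DT, of w ?U] w by blast
      show "((\<lambda>x. g (x + v) - g x) has_derivative (\<lambda>h. blinfun_apply (Dg (w + v)) h - blinfun_apply (Dg w) h)) (at w within ?U)"
        by (rule has_derivative_diff[OF 1 2])
      have "onorm (\<lambda>h. blinfun_apply (Dg (w + v)) h - blinfun_apply (Dg w) h) = norm (Dg (w + v) - Dg w)"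
        by (simp add: norm_blinfun.rep_eq minus_blinfun.rep_eq)
      also have "\<dots> \<le> M * norm v" using L1[of "w + v" w] w by simp
      finally show "onorm (\<lambda>h. blinfun_apply (Dg (w + v)) h - blinfun_apply (Dg w) h) \<le> M * norm v" .
    qed (use xy in auto)
    then show ?thesis by (simp add: algebra_simps)
  qed
  show ?thesis
    unfolding C2_bounds_def using M M0 L0 second mixed by blast
qed

text \<open>\<open>Psi1\<close> and \<open>Psi2\<close> are unbounded in u, so C^2 regularity gives
  no global constants; these are their compact convex truncations.\<close>

definition tri1 :: "real \<Rightarrow> (real \<times> real \<times> real) set" where
  "tri1 R = {(s,t,u). 0 \<le> t \<and> t \<le> s \<and> s \<le> 1 \<and> -R \<le> u \<and> u \<le> R}"
definition tri2 :: "real \<Rightarrow> (real \<times> real \<times> real) set" where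
  "tri2 R = {(s,t,u). 0 \<le> s \<and> s \<le> t \<and> t \<le> 1 \<and> -R \<le> u \<and> u \<le> R}"

lemma compact_tri: "compact (tri1 R)" "compact (tri2 R)"
proof -
  have "tri1 R = cbox (0,0,-R) (1,1,R) \<inter> {x. fst (snd x) \<le> fst x}"
    "tri2 R = cbox (0,0,-R) (1,1,R) \<inter> {x. fst x \<le> fst (snd x)}"
    by (auto simp: tri1_def tri2_def cbox_Pair_eq)
  moreover have "closed {x::real\<times>real\<times>real. fst (snd x) \<le> fst x}" "closed {x::real\<times>real\<times>real. fst x \<le> fst (snd x)}"
    by (intro closed_Collect_le continuous_intros)+
  ultimately show "compact (tri1 R)" "compact (tri2 R)" by (auto intro!: compact_Int_closed)
qed

lemma convex_tri: "convex (tri1 R)" "convex (tri2 R)"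
proof -
  have c: "0 \<le> p \<Longrightarrow> 0 \<le> q \<Longrightarrow> a \<le> b \<Longrightarrow> a' \<le> b' \<Longrightarrow> p * a + q * a' \<le> p * b + q * b'" for a b a' b' p q :: real
    by (intro add_mono mult_left_mono)
  have d: "0 \<le> p \<Longrightarrow> 0 \<le> q \<Longrightarrow> p + q = 1 \<Longrightarrow> a \<le> r \<Longrightarrow> a' \<le> r \<Longrightarrow> p * a + q * a' \<le> r" for a a' r p q :: real
    by (rule convex_bound_le)
  have e: "0 \<le> p \<Longrightarrow> 0 \<le> q \<Longrightarrow> p + q = 1 \<Longrightarrow> r \<le> a \<Longrightarrow> r \<le> a' \<Longrightarrow> r \<le> p * a + q * a'" for a a' r p q :: real
    using convex_bound_le[of "-a" "-r" "-a'" p q] by simp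
  show "convex (tri1 R)" "convex (tri2 R)"
    by (auto simp: convex_def tri1_def tri2_def intro!: c d e)
qed

text \<open>The Lipschitz clauses hold across the diagonal. The second and mixed differences carry a
  side condition that keeps all points in one of the two triangles, since derivatives may jump in
  between. \<open>k_second_t\<close> has three separate last arguments because it is applied with
  the values of a function at t + h, t and t - h.\<close>

locale kernel_bounds =
  fixes \<kappa> l :: "real \<Rightarrow> real \<Rightarrow> real \<Rightarrow> real" and R M :: real
  assumes M_nonneg: "0 \<le> M"
    and deriv: "s \<in> {0..1} \<Longrightarrow> t \<in> {0..1} \<Longrightarrow> ((\<lambda>v. \<kappa> s t v) has_real_derivative l s t u) (at u)"
    and k_bound: "s \<in> {0..1} \<Longrightarrow> t \<in> {0..1} \<Longrightarrow> \<bar>u\<bar> \<le> R \<Longrightarrow> \<bar>\<kappa> s t u\<bar> \<le> M"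
    and l_bound: "s \<in> {0..1} \<Longrightarrow> t \<in> {0..1} \<Longrightarrow> \<bar>u\<bar> \<le> R \<Longrightarrow> \<bar>l s t u\<bar> \<le> M"
    and k_lip_s: "s \<in> {0..1} \<Longrightarrow> s' \<in> {0..1} \<Longrightarrow> t \<in> {0..1} \<Longrightarrow> \<bar>u\<bar> \<le> R \<Longrightarrow> \<bar>\<kappa> s t u - \<kappa> s' t u\<bar> \<le> M * \<bar>s - s'\<bar>"
    and k_lip_t: "s \<in> {0..1} \<Longrightarrow> t \<in> {0..1} \<Longrightarrow> t' \<in> {0..1} \<Longrightarrow> \<bar>u\<bar> \<le> R \<Longrightarrow> \<bar>\<kappa> s t u - \<kappa> s t' u\<bar> \<le> M * \<bar>t - t'\<bar>"
    and l_lip_s: "s \<in> {0..1} \<Longrightarrow> s' \<in> {0..1} \<Longrightarrow> t \<in> {0..1} \<Longrightarrow> \<bar>u\<bar> \<le> R \<Longrightarrow> \<bar>l s t u - l s' t u\<bar> \<le> M * \<bar>s - s'\<bar>"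
    and l_lip_t: "s \<in> {0..1} \<Longrightarrow> t \<in> {0..1} \<Longrightarrow> t' \<in> {0..1} \<Longrightarrow> \<bar>u\<bar> \<le> R \<Longrightarrow> \<bar>l s t u - l s t' u\<bar> \<le> M * \<bar>t - t'\<bar>"
    and l_lip_u: "s \<in> {0..1} \<Longrightarrow> t \<in> {0..1} \<Longrightarrow> \<bar>u\<bar> \<le> R \<Longrightarrow> \<bar>u'\<bar> \<le> R \<Longrightarrow> \<bar>l s t u - l s t u'\<bar> \<le> M * \<bar>u - u'\<bar>"
    and k_second_s: "s - h \<in> {0..1} \<Longrightarrow> s + h \<in> {0..1} \<Longrightarrow> t \<in> {0..1} \<Longrightarrow> \<bar>u\<bar> \<le> R \<Longrightarrow>
        (t \<le> s - h \<and> t \<le> s + h) \<or> (s - h \<le> t \<and> s + h \<le> t) \<Longrightarrow>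
        \<bar>\<kappa> (s + h) t u - 2 * \<kappa> s t u + \<kappa> (s - h) t u\<bar> \<le> M * h^2"
    and k_second_t: "t - h \<in> {0..1} \<Longrightarrow> t + h \<in> {0..1} \<Longrightarrow> s \<in> {0..1} \<Longrightarrow>
        \<bar>a\<bar> \<le> R \<Longrightarrow> \<bar>b\<bar> \<le> R \<Longrightarrow> \<bar>c\<bar> \<le> R \<Longrightarrow>
        (s \<le> t - h \<and> s \<le> t + h) \<or> (t - h \<le> s \<and> t + h \<le> s) \<Longrightarrow>
        \<bar>\<kappa> s (t + h) a - 2 * \<kappa> s t b + \<kappa> s (t - h) c\<bar>
          \<le> M * (h^2 + (a - b)^2 + (c - b)^2 + \<bar>a - 2 * b + c\<bar>)"
    and l_mixed: "s \<in> {0..1} \<Longrightarrow> s' \<in> {0..1} \<Longrightarrow> t \<in> {0..1} \<Longrightarrow> t' \<in> {0..1} \<Longrightarrow> \<bar>u\<bar> \<le> R \<Longrightarrow> \<bar>u'\<bar> \<le> R \<Longrightarrow>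
        (t \<le> s \<and> t \<le> s' \<and> t' \<le> s \<and> t' \<le> s') \<or> (s \<le> t \<and> s' \<le> t \<and> s \<le> t' \<and> s' \<le> t') \<Longrightarrow>
        \<bar>l s t u - l s' t u - l s t' u' + l s' t' u'\<bar> \<le> M * \<bar>s - s'\<bar> * (\<bar>t - t'\<bar> + \<bar>u - u'\<bar>)"

text \<open>On the line, a detour through a point in between adds no length, so equal Lipschitz
  constants on both sides of the diagonal join into one.\<close>

lemma lipschitz_glue:
  fixes f :: "real \<Rightarrow> real"
  assumes 1: "\<And>x y. x \<in> A \<Longrightarrow> y \<in> A \<Longrightarrow> x \<le> c \<Longrightarrow> y \<le> c \<Longrightarrow> \<bar>f x - f y\<bar> \<le> M * \<bar>x - y\<bar>"
    and 2: "\<And>x y. x \<in> A \<Longrightarrow> y \<in> A \<Longrightarrow> c \<le> x \<Longrightarrow> c \<le> y \<Longrightarrow> \<bar>f x - f y\<bar> \<le> M * \<bar>x - y\<bar>"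
    and "c \<in> A" "x \<in> A" "y \<in> A"
  shows "\<bar>f x - f y\<bar> \<le> M * \<bar>x - y\<bar>"
proof -
  have *: "\<bar>f a - f b\<bar> \<le> M * \<bar>a - b\<bar>" if "a \<in> A" "b \<in> A" "a \<le> c" "c \<le> b" for a b
  proof -
    have "\<bar>f a - f c\<bar> \<le> M * \<bar>a - c\<bar>" "\<bar>f c - f b\<bar> \<le> M * \<bar>c - b\<bar>"
      using 1[of a c] 2[of c b] assms(3) that by simp_all
    then have "\<bar>f a - f b\<bar> \<le> M * \<bar>a - c\<bar> + M * \<bar>c - b\<bar>" by linarith
    also have "\<dots> = M * \<bar>a - b\<bar>" using that by (simp add: algebra_simps)
    finally show ?thesis .
  qed
  show ?thesis
    using 1[of x y] 2[of x y] *[of x y] *[of y x] assms(3-) by (smt (verit, best) abs_minus_commute)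
qed

text \<open>The order of quantifiers gives one l with a constant for every radius: the estimates use
  a fixed R, but the discrete equation first brings in values u that are not yet known to be bounded
  by it.\<close>

lemma kernel_bounds_exist:
  assumes "kernel_G2_2_0 \<kappa>"
  shows "\<exists>l. \<forall>R. \<exists>M. kernel_bounds \<kappa> l R M"
proof -
  obtain l lu l1 l2 k1 k2 where
    der: "\<forall>(s,t,u)\<in>Psi. ((\<lambda>v. \<kappa> s t v) has_real_derivative l s t u) (at u)"
    and l1: "C2_on Psi1 l1" "\<forall>(s,t,u)\<in>Psi1. l s t u = l1 (s,t,u)"
    and l2: "C2_on Psi2 l2" "\<forall>(s,t,u)\<in>Psi2. l s t u = l2 (s,t,u)"
    and k1: "C2_on Psi1 k1" "\<forall>(s,t,u)\<in>Psi1. \<kappa> s t u = k1 (s,t,u)"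
    and k2: "C2_on Psi2 k2" "\<forall>(s,t,u)\<in>Psi2. \<kappa> s t u = k2 (s,t,u)"
    using assms unfolding kernel_G2_2_0_def by (elim exE conjE) (rule that; assumption)
  have "\<exists>M. kernel_bounds \<kappa> l R M" for R
  proof -
    have sub: "tri1 R \<subseteq> Psi1" "tri2 R \<subseteq> Psi2" by (auto simp: tri1_def tri2_def Psi1_def Psi2_def)
    obtain A1 A2 A3 A4 where A: "C2_bounds (tri1 R) l1 A1" "C2_bounds (tri2 R) l2 A2"
      "C2_bounds (tri1 R) k1 A3" "C2_bounds (tri2 R) k2 A4"
      using C2_on_bounds[OF l1(1) sub(1) compact_tri(1) convex_tri(1)]
        C2_on_bounds[OF l2(1) sub(2) compact_tri(2) convex_tri(2)]
        C2_on_bounds[OF k1(1) sub(1) compact_tri(1) convex_tri(1)]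
        C2_on_bounds[OF k2(1) sub(2) compact_tri(2) convex_tri(2)] by blast
    define B where "B = \<bar>A1\<bar> + \<bar>A2\<bar> + \<bar>A3\<bar> + \<bar>A4\<bar>"
    have B: "C2_bounds (tri1 R) l1 B" "C2_bounds (tri2 R) l2 B" "C2_bounds (tri1 R) k1 B" "C2_bounds (tri2 R) k2 B"
      using A[THEN C2_bounds_mono, of B] by (simp_all add: B_def)
    have B0: "B \<ge> 0" by (simp add: B_def)
    have le1: "\<kappa> s t u = k1 (s,t,u)" "l s t u = l1 (s,t,u)" "(s,t,u) \<in> tri1 R"
      if "0 \<le> t" "t \<le> s" "s \<le> 1" "\<bar>u\<bar> \<le> R" for s t u
      using that k1 l1 by (auto simp: Psi1_def tri1_def)
    have le2: "\<kappa> s t u = k2 (s,t,u)" "l s t u = l2 (s,t,u)" "(s,t,u) \<in> tri2 R"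
      if "0 \<le> s" "s \<le> t" "t \<le> 1" "\<bar>u\<bar> \<le> R" for s t u
      using that k2 l2 by (auto simp: Psi2_def tri2_def)
    have bnd: "\<bar>g x\<bar> \<le> B" if "C2_bounds T g B" "x \<in> T" for g x and T :: "(real \<times> real \<times> real) set"
      using that unfolding C2_bounds_def by blast
    have lip: "\<bar>g x - g y\<bar> \<le> B * norm (x - y)" if "C2_bounds T g B" "x \<in> T" "y \<in> T" for g x y and T :: "(real \<times> real \<times> real) set"
      using that unfolding C2_bounds_def by blast
    have sec: "\<bar>g y - 2 * g x + g y'\<bar> \<le> B * (norm (y - x)^2 + norm (y' - x)^2 + norm ((y - x) + (y' - x)))"
      if "C2_bounds T g B" "x \<in> T" "y \<in> T" "y' \<in> T" for g x y y' and T :: "(real \<times> real \<times> real) set"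
      using that unfolding C2_bounds_def by blast
    have mix: "\<bar>g (x + v) - g x - g (y + v) + g y\<bar> \<le> B * norm v * norm (x - y)"
      if "C2_bounds T g B" "x \<in> T" "y \<in> T" "x + v \<in> T" "y + v \<in> T" for g x y v and T :: "(real \<times> real \<times> real) set"
      using that unfolding C2_bounds_def by blast
    have up: "B * x \<le> 3 * B * x" if "0 \<le> x" for x using that B0 by (simp add: mult_right_mono)
    have ntu: "norm (0::real, t, u) \<le> \<bar>t\<bar> + \<bar>u\<bar>" for t u :: real
      by (simp add: norm_Pair sqrt_sum_squares_le_sum_abs)
    have secs: "\<bar>g (s + h, t, u) - 2 * g (s, t, u) + g (s - h, t, u)\<bar> \<le> 3 * B * h^2"
      if "C2_bounds T g B" "(s, t, u) \<in> T" "(s + h, t, u) \<in> T" "(s - h, t, u) \<in> T"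
      for g s t u h and T :: "(real \<times> real \<times> real) set"
      using sec[OF that] up[of "h^2"] by (simp add: norm_Pair)
    have sect: "\<bar>g (s, t + h, a) - 2 * g (s, t, b) + g (s, t - h, c)\<bar>
        \<le> 3 * B * (h^2 + (a - b)^2 + (c - b)^2 + \<bar>a - 2 * b + c\<bar>)"
      if "C2_bounds T g B" "(s, t, b) \<in> T" "(s, t + h, a) \<in> T" "(s, t - h, c) \<in> T"
      for g s t a b c h and T :: "(real \<times> real \<times> real) set"
    proof -
      have "\<bar>g (s, t + h, a) - 2 * g (s, t, b) + g (s, t - h, c)\<bar>
          \<le> B * ((h^2 + (a - b)^2) + (h^2 + (c - b)^2) + \<bar>a - 2 * b + c\<bar>)"
        using sec[OF that] by (simp add: norm_Pair algebra_simps)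
      also have "\<dots> \<le> B * (3 * (h^2 + (a - b)^2 + (c - b)^2 + \<bar>a - 2 * b + c\<bar>))"
        using B0 by (intro mult_left_mono) auto
      finally show ?thesis by (simp add: algebra_simps)
    qed
    have mixs: "\<bar>g (s, t, u) - g (s', t, u) - g (s, t', u') + g (s', t', u')\<bar> \<le> 3 * B * \<bar>s - s'\<bar> * (\<bar>t - t'\<bar> + \<bar>u - u'\<bar>)"
      if "C2_bounds T g B" "(s', t, u) \<in> T" "(s', t', u') \<in> T" "(s, t, u) \<in> T" "(s, t', u') \<in> T"
      for g s t u s' t' u' and T :: "(real \<times> real \<times> real) set"
    proof -
      have "\<bar>g (s, t, u) - g (s', t, u) - g (s, t', u') + g (s', t', u')\<bar>
          \<le> B * \<bar>s - s'\<bar> * norm (0::real, t - t', u - u')"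
        using mix[of T g "(s',t,u)" "(s',t',u')" "(s - s', 0, 0)"] that by (simp add: norm_Pair)
      also have "\<dots> \<le> B * \<bar>s - s'\<bar> * (\<bar>t - t'\<bar> + \<bar>u - u'\<bar>)"
        using B0 ntu by (intro mult_left_mono) auto
      also have "\<dots> \<le> 3 * (B * \<bar>s - s'\<bar> * (\<bar>t - t'\<bar> + \<bar>u - u'\<bar>))" using B0 by simp
      finally show ?thesis by (simp add: mult.assoc)
    qed
    have lip3: "\<bar>g (s,t,u) - g (s',t,u)\<bar> \<le> 3 * B * \<bar>s - s'\<bar>" if "C2_bounds T g B" "(s,t,u) \<in> T" "(s',t,u) \<in> T"
      for g s s' t u and T :: "(real \<times> real \<times> real) set"
      using lip[OF that] up[of "\<bar>s - s'\<bar>"] by (simp add: norm_Pair)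
    have lip4: "\<bar>g (s,t,u) - g (s,t',u)\<bar> \<le> 3 * B * \<bar>t - t'\<bar>" if "C2_bounds T g B" "(s,t,u) \<in> T" "(s,t',u) \<in> T"
      for g s t' t u and T :: "(real \<times> real \<times> real) set"
      using lip[OF that] up[of "\<bar>t - t'\<bar>"] by (simp add: norm_Pair)
    have lip5: "\<bar>g (s,t,u) - g (s,t,u')\<bar> \<le> 3 * B * \<bar>u - u'\<bar>" if "C2_bounds T g B" "(s,t,u) \<in> T" "(s,t,u') \<in> T"
      for g s u' t u and T :: "(real \<times> real \<times> real) set"
      using lip[OF that] up[of "\<bar>u - u'\<bar>"] by (simp add: norm_Pair)
    have b3: "\<bar>g x\<bar> \<le> 3 * B" if "C2_bounds T g B" "x \<in> T" for g x and T :: "(real \<times> real \<times> real) set"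
      using bnd[OF that] B0 by linarith
    \<comment> \<open>The factor 3 absorbs the two copies of h^2 that \<open>sec\<close> produces;
      the other clauses are weakened to the same constant.\<close>
    have "kernel_bounds \<kappa> l R (3 * B)"
    proof
      show "0 \<le> 3 * B" using B0 by simp
      show "((\<lambda>v. \<kappa> s t v) has_real_derivative l s t u) (at u)" if "s \<in> {0..1}" "t \<in> {0..1}" for s t u
        using der that by (auto simp: Psi_def)
    next
      fix s t u :: real assume a: "s \<in> {0..1}" "t \<in> {0..1}" "\<bar>u\<bar> \<le> R"
      show "\<bar>\<kappa> s t u\<bar> \<le> 3 * B"
        using a le1[of t s u] le2[of s t u] b3[OF B(3), of "(s,t,u)"] b3[OF B(4), of "(s,t,u)"]
        by (cases "t \<le> s") simp_all
      show "\<bar>l s t u\<bar> \<le> 3 * B"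
        using a le1[of t s u] le2[of s t u] b3[OF B(1), of "(s,t,u)"] b3[OF B(2), of "(s,t,u)"]
        by (cases "t \<le> s") simp_all
    next
      fix s s' t u :: real assume a: "s \<in> {0..1}" "s' \<in> {0..1}" "t \<in> {0..1}" "\<bar>u\<bar> \<le> R"
      show "\<bar>\<kappa> s t u - \<kappa> s' t u\<bar> \<le> 3 * B * \<bar>s - s'\<bar>"
      proof (rule lipschitz_glue[where A="{0..1}" and c=t])
        fix x y :: real assume xy: "x \<in> {0..1}" "y \<in> {0..1}"
        show "\<bar>\<kappa> x t u - \<kappa> y t u\<bar> \<le> 3 * B * \<bar>x - y\<bar>" if "x \<le> t" "y \<le> t"
          using le2[of x t u] le2[of y t u] xy that a lip3[OF B(4), of x t u y] by simp
        show "\<bar>\<kappa> x t u - \<kappa> y t u\<bar> \<le> 3 * B * \<bar>x - y\<bar>" if "t \<le> x" "t \<le> y"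
          using le1[of t x u] le1[of t y u] xy that a lip3[OF B(3), of x t u y] by simp
      qed (use a in auto)
      show "\<bar>l s t u - l s' t u\<bar> \<le> 3 * B * \<bar>s - s'\<bar>"
      proof (rule lipschitz_glue[where A="{0..1}" and c=t])
        fix x y :: real assume xy: "x \<in> {0..1}" "y \<in> {0..1}"
        show "\<bar>l x t u - l y t u\<bar> \<le> 3 * B * \<bar>x - y\<bar>" if "x \<le> t" "y \<le> t"
          using le2[of x t u] le2[of y t u] xy that a lip3[OF B(2), of x t u y] by simp
        show "\<bar>l x t u - l y t u\<bar> \<le> 3 * B * \<bar>x - y\<bar>" if "t \<le> x" "t \<le> y"
          using le1[of t x u] le1[of t y u] xy that a lip3[OF B(1), of x t u y] by simp
      qed (use a in auto)
    next
      fix s t t' u :: real assume a: "s \<in> {0..1}" "t \<in> {0..1}" "t' \<in> {0..1}" "\<bar>u\<bar> \<le> R"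
      show "\<bar>\<kappa> s t u - \<kappa> s t' u\<bar> \<le> 3 * B * \<bar>t - t'\<bar>"
      proof (rule lipschitz_glue[where A="{0..1}" and c=s])
        fix x y :: real assume xy: "x \<in> {0..1}" "y \<in> {0..1}"
        show "\<bar>\<kappa> s x u - \<kappa> s y u\<bar> \<le> 3 * B * \<bar>x - y\<bar>" if "x \<le> s" "y \<le> s"
          using le1[of x s u] le1[of y s u] xy that a lip4[OF B(3), of s x u y] by simp
        show "\<bar>\<kappa> s x u - \<kappa> s y u\<bar> \<le> 3 * B * \<bar>x - y\<bar>" if "s \<le> x" "s \<le> y"
          using le2[of s x u] le2[of s y u] xy that a lip4[OF B(4), of s x u y] by simp
      qed (use a in auto)
      show "\<bar>l s t u - l s t' u\<bar> \<le> 3 * B * \<bar>t - t'\<bar>"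
      proof (rule lipschitz_glue[where A="{0..1}" and c=s])
        fix x y :: real assume xy: "x \<in> {0..1}" "y \<in> {0..1}"
        show "\<bar>l s x u - l s y u\<bar> \<le> 3 * B * \<bar>x - y\<bar>" if "x \<le> s" "y \<le> s"
          using le1[of x s u] le1[of y s u] xy that a lip4[OF B(1), of s x u y] by simp
        show "\<bar>l s x u - l s y u\<bar> \<le> 3 * B * \<bar>x - y\<bar>" if "s \<le> x" "s \<le> y"
          using le2[of s x u] le2[of s y u] xy that a lip4[OF B(2), of s x u y] by simp
      qed (use a in auto)
    next
      fix s t u u' :: real assume a: "s \<in> {0..1}" "t \<in> {0..1}" "\<bar>u\<bar> \<le> R" "\<bar>u'\<bar> \<le> R"
      show "\<bar>l s t u - l s t u'\<bar> \<le> 3 * B * \<bar>u - u'\<bar>"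
        using a le1[of t s u] le2[of s t u] le1[of t s u'] le2[of s t u']
          lip5[OF B(1), of s t u u'] lip5[OF B(2), of s t u u'] by (cases "t \<le> s") auto
    next
      fix s h t u :: real assume a: "s - h \<in> {0..1}" "s + h \<in> {0..1}" "t \<in> {0..1}" "\<bar>u\<bar> \<le> R"
        "(t \<le> s - h \<and> t \<le> s + h) \<or> (s - h \<le> t \<and> s + h \<le> t)"
      from a(5) show "\<bar>\<kappa> (s + h) t u - 2 * \<kappa> s t u + \<kappa> (s - h) t u\<bar> \<le> 3 * B * h^2"
      proof
        assume "t \<le> s - h \<and> t \<le> s + h"
        then have "0 \<le> t" "t \<le> s - h" "t \<le> s + h" "t \<le> s" "s - h \<le> 1" "s + h \<le> 1" "s \<le> 1" using a by auto
        then show ?thesis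
          using le1[of t s u] le1[of t "s+h" u] le1[of t "s-h" u] a(4) secs[OF B(3), of s t u h] by simp
      next
        assume "s - h \<le> t \<and> s + h \<le> t"
        then have "t \<le> 1" "s - h \<le> t" "s + h \<le> t" "s \<le> t" "0 \<le> s - h" "0 \<le> s + h" "0 \<le> s" using a by auto
        then show ?thesis
          using le2[of s t u] le2[of "s+h" t u] le2[of "s-h" t u] a(4) secs[OF B(4), of s t u h] by simp
      qed
    next
      fix s h t b c d :: real assume a: "t - h \<in> {0..1}" "t + h \<in> {0..1}" "s \<in> {0..1}" "\<bar>b\<bar> \<le> R" "\<bar>c\<bar> \<le> R" "\<bar>d\<bar> \<le> R"
        "(s \<le> t - h \<and> s \<le> t + h) \<or> (t - h \<le> s \<and> t + h \<le> s)"
      from a(7) show "\<bar>\<kappa> s (t + h) b - 2 * \<kappa> s t c + \<kappa> s (t - h) d\<bar>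
           \<le> 3 * B * (h^2 + (b - c)^2 + (d - c)^2 + \<bar>b - 2 * c + d\<bar>)"
      proof
        assume "s \<le> t - h \<and> s \<le> t + h"
        then have "0 \<le> s" "s \<le> t - h" "s \<le> t + h" "s \<le> t" "t - h \<le> 1" "t + h \<le> 1" "t \<le> 1" using a by auto
        then show ?thesis
          using le2[of s t c] le2[of s "t+h" b] le2[of s "t-h" d] a(4-6) sect[OF B(4), of s t c h b d] by simp
      next
        assume "t - h \<le> s \<and> t + h \<le> s"
        then have "s \<le> 1" "t - h \<le> s" "t + h \<le> s" "t \<le> s" "0 \<le> t - h" "0 \<le> t + h" "0 \<le> t" using a by auto
        then show ?thesis
          using le1[of t s c] le1[of "t+h" s b] le1[of "t-h" s d] a(4-6) sect[OF B(3), of s t c h b d] by simp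
      qed
    next
      fix s s' t t' u u' :: real
      assume a: "s \<in> {0..1}" "s' \<in> {0..1}" "t \<in> {0..1}" "t' \<in> {0..1}" "\<bar>u\<bar> \<le> R" "\<bar>u'\<bar> \<le> R"
        "(t \<le> s \<and> t \<le> s' \<and> t' \<le> s \<and> t' \<le> s') \<or> (s \<le> t \<and> s' \<le> t \<and> s \<le> t' \<and> s' \<le> t')"
      from a(7) show "\<bar>l s t u - l s' t u - l s t' u' + l s' t' u'\<bar> \<le> 3 * B * \<bar>s - s'\<bar> * (\<bar>t - t'\<bar> + \<bar>u - u'\<bar>)"
      proof
        assume "t \<le> s \<and> t \<le> s' \<and> t' \<le> s \<and> t' \<le> s'"
        then show ?thesis
          using le1[of t s u] le1[of t s' u] le1[of t' s u'] le1[of t' s' u'] a(1-6)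
            mixs[OF B(1), of s' t u t' u' s] by simp
      next
        assume "s \<le> t \<and> s' \<le> t \<and> s \<le> t' \<and> s' \<le> t'"
        then show ?thesis
          using le2[of s t u] le2[of s' t u] le2[of s t' u'] le2[of s' t' u'] a(1-6)
            mixs[OF B(2), of s' t u t' u' s] by simp
      qed
    qed
    then show ?thesis by blast
  qed
  then show ?thesis by blast
qed

section \<open>Consistency\<close>

text \<open>The second conclusion says that \<xi> lies between u and v in the form in which it is
  used: with centre 0 it keeps \<xi> within the radius R, with another centre it keeps \<xi> close
  to a reference value.\<close>

lemma real_mean_value:
  fixes f :: "real \<Rightarrow> real"
  assumes "\<And>x. (f has_real_derivative f' x) (at x)"
  obtains \<xi> where "f u - f v = f' \<xi> * (u - v)" "\<And>a e. \<bar>u - a\<bar> \<le> e \<Longrightarrow> \<bar>v - a\<bar> \<le> e \<Longrightarrow> \<bar>\<xi> - a\<bar> \<le> e"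
proof (cases u v rule: linorder_cases)
  case less
  then obtain z where "u < z" "z < v" "f v - f u = (v - u) * f' z" using MVT2[of u v f f'] assms by blast
  then show ?thesis by (intro that[of z]) (auto simp: algebra_simps abs_le_iff)
next
  case equal
  then show ?thesis by (intro that[of u]) auto
next
  case greater
  then obtain z where "v < z" "z < u" "f u - f v = (u - v) * f' z" using MVT2[of v u f f'] assms by blast
  then show ?thesis by (intro that[of z]) (auto simp: algebra_simps abs_le_iff)
qed

lemma continuous_on_lipschitz2:
  fixes g :: "real \<Rightarrow> real \<Rightarrow> real"
  assumes "0 \<le> M"
    and "\<And>t t' u. t \<in> A \<Longrightarrow> t' \<in> A \<Longrightarrow> u \<in> B \<Longrightarrow> \<bar>g t u - g t' u\<bar> \<le> M * \<bar>t - t'\<bar>"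
    and "\<And>t u u'. t \<in> A \<Longrightarrow> u \<in> B \<Longrightarrow> u' \<in> B \<Longrightarrow> \<bar>g t u - g t u'\<bar> \<le> M * \<bar>u - u'\<bar>"
  shows "continuous_on (A \<times> B) (\<lambda>(t,u). g t u)"
proof (rule lipschitz_on_continuous_on[of "2 * M"], rule lipschitz_onI)
  fix x y assume xy: "x \<in> A \<times> B" "y \<in> A \<times> B"
  obtain t u t' u' where [simp]: "x = (t,u)" "y = (t',u')" by (cases x, cases y)
  have "\<bar>g t u - g t' u'\<bar> \<le> M * \<bar>t - t'\<bar> + M * \<bar>u - u'\<bar>"
    using assms(2)[of t t' u] assms(3)[of t' u u'] xy by auto
  moreover have "\<bar>t - t'\<bar> \<le> dist x y" "\<bar>u - u'\<bar> \<le> dist x y"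
    using dist_fst_le[of x y] dist_snd_le[of x y] by (auto simp: dist_real_def)
  then have "M * \<bar>t - t'\<bar> \<le> M * dist x y" "M * \<bar>u - u'\<bar> \<le> M * dist x y"
    using assms(1) by (auto intro: mult_left_mono)
  ultimately show "dist (case x of (t,u) \<Rightarrow> g t u) (case y of (t,u) \<Rightarrow> g t u) \<le> 2 * M * dist x y"
    by (simp add: dist_real_def)
qed (use assms in simp)

lemma cell_avg_dev:
  assumes "n \<ge> 1" "p \<ge> 1" "j \<ge> 1"
    "\<And>t. (real j - 1) / real n < t \<Longrightarrow> t < real j / real n \<Longrightarrow> \<bar>v t - c\<bar> \<le> B"
  shows "\<bar>cell_avg n p j v - c\<bar> \<le> B"
  using cell_avg_bound[of n p j "\<lambda>t. v t - c" B] assms by (simp add: cell_avg_diff cell_avg_const)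

lemma cell_subset_unit:
  assumes "j \<in> {1..n}" "(real j - 1) / real n \<le> t" "t \<le> real j / real n"
  shows "t \<in> {0..1}"
  using subinterval_unit[OF assms(1)] assms(2,3) by (meson atLeastAtMost_iff subsetD)

lemma Qform_bound:
  assumes "n \<ge> 1" "p \<ge> 1" "s \<in> {0..1}" "\<And>t. t \<in> {0..1} \<Longrightarrow> \<bar>v t\<bar> \<le> B"
  shows "\<bar>Qform n p v s\<bar> \<le> B"
  unfolding Qform_cell_avg
proof (rule cell_avg_bound[OF assms(1,2)])
  note P = pidx_in_cell[OF assms(1,3)]
  show "1 \<le> pidx n s" using P(1) by auto
  fix t assume "(real (pidx n s) - 1) / real n < t" "t < real (pidx n s) / real n"
  then show "\<bar>v t\<bar> \<le> B" using cell_subset_unit[OF P(1), of t] assms(4) by simp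
qed

lemma cell_dist:
  assumes "(real j - 1) / real n \<le> t" "t \<le> real j / real n" "(real j - 1) / real n \<le> t'" "t' \<le> real j / real n"
  shows "\<bar>t - t'\<bar> \<le> 1 / real n"
  using assms by (simp add: diff_divide_distrib abs_le_iff)

text \<open>The average over the cell of s is a convex combination of values of v at points within
  1/n of s.\<close>

lemma Qform_lipschitz_error:
  assumes "n \<ge> 1" "p \<ge> 1" "s \<in> {0..1}" "0 \<le> B"
    and "\<And>t t'. t \<in> {0..1} \<Longrightarrow> t' \<in> {0..1} \<Longrightarrow> \<bar>v t - v t'\<bar> \<le> B * \<bar>t - t'\<bar>"
  shows "\<bar>Qform n p v s - v s\<bar> \<le> B * (1 / real n)"
  unfolding Qform_cell_avg
proof (rule cell_avg_dev[OF assms(1,2)])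
  note P = pidx_in_cell[OF assms(1,3)]
  show "1 \<le> pidx n s" using P(1) by auto
  fix t assume t: "(real (pidx n s) - 1) / real n < t" "t < real (pidx n s) / real n"
  have "t \<in> {0..1}" using cell_subset_unit[OF P(1)] t by auto
  then have "\<bar>v t - v s\<bar> \<le> B * \<bar>t - s\<bar>" using assms by blast
  also have "\<dots> \<le> B * (1 / real n)"
    using t P by (intro mult_left_mono cell_dist assms) auto
  finally show "\<bar>v t - v s\<bar> \<le> B * (1 / real n)" .
qed

lemma Qform_diff: "Qform n p (\<lambda>t. g t - h t) s = Qform n p g s - Qform n p h s"
  by (simp add: Qform_cell_avg cell_avg_diff)

section \<open>Pointwise kernel estimates, the integral operator and the consistency error\<close>

context kernel_bounds
begin

lemma k_lip_u:
  assumes "s \<in> {0..1}" "t \<in> {0..1}" "\<bar>u\<bar> \<le> R" "\<bar>u'\<bar> \<le> R"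
  shows "\<bar>\<kappa> s t u - \<kappa> s t u'\<bar> \<le> M * \<bar>u - u'\<bar>"
proof -
  obtain \<xi> where x: "\<kappa> s t u - \<kappa> s t u' = l s t \<xi> * (u - u')"
    "\<And>a e. \<bar>u - a\<bar> \<le> e \<Longrightarrow> \<bar>u' - a\<bar> \<le> e \<Longrightarrow> \<bar>\<xi> - a\<bar> \<le> e"
    using real_mean_value[OF deriv[OF assms(1,2)], of u u'] by blast
  have "\<bar>l s t \<xi>\<bar> \<le> M" using x(2)[of 0 R] assms by (intro l_bound) auto
  then show ?thesis unfolding x(1) abs_mult by (rule mult_right_mono) simp
qed

text \<open>The mean value point lies between u and u', so moving l from there to u' costs a second
  factor |u - u'| by Lipschitz continuity of l in u.\<close>

lemma k_linearize:
  assumes "s \<in> {0..1}" "t \<in> {0..1}" "\<bar>u\<bar> \<le> R" "\<bar>u'\<bar> \<le> R"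
  shows "\<bar>\<kappa> s t u - \<kappa> s t u' - l s t u' * (u - u')\<bar> \<le> M * (u - u')^2"
proof -
  obtain \<xi> where x: "\<kappa> s t u - \<kappa> s t u' = l s t \<xi> * (u - u')"
    "\<And>a e. \<bar>u - a\<bar> \<le> e \<Longrightarrow> \<bar>u' - a\<bar> \<le> e \<Longrightarrow> \<bar>\<xi> - a\<bar> \<le> e"
    using real_mean_value[OF deriv[OF assms(1,2)], of u u'] by blast
  have "\<bar>l s t \<xi> - l s t u'\<bar> \<le> M * \<bar>\<xi> - u'\<bar>" using x(2)[of 0 R] assms by (intro l_lip_u) auto
  also have "\<dots> \<le> M * \<bar>u - u'\<bar>" using x(2)[of u' "\<bar>u - u'\<bar>"] M_nonneg by (intro mult_left_mono) auto
  finally have "\<bar>l s t \<xi> - l s t u'\<bar> * \<bar>u - u'\<bar> \<le> (M * \<bar>u - u'\<bar>) * \<bar>u - u'\<bar>"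
    by (rule mult_right_mono) simp
  moreover have "\<kappa> s t u - \<kappa> s t u' - l s t u' * (u - u') = (l s t \<xi> - l s t u') * (u - u')"
    unfolding x(1) by (simp add: algebra_simps)
  ultimately show ?thesis by (simp add: abs_mult power2_eq_square mult.assoc)
qed

text \<open>The mean value theorem is applied to the difference of the two kernel sections, so that
  one intermediate point serves both s and s'; separate points would lose the smallness in s -
  s'.\<close>

lemma k_cross_mean_value:
  assumes "s \<in> {0..1}" "s' \<in> {0..1}" "t \<in> {0..1}"
  obtains \<xi> where "\<kappa> s t u - \<kappa> s' t u - (\<kappa> s t u' - \<kappa> s' t u') = (l s t \<xi> - l s' t \<xi>) * (u - u')"
    "\<And>a e. \<bar>u - a\<bar> \<le> e \<Longrightarrow> \<bar>u' - a\<bar> \<le> e \<Longrightarrow> \<bar>\<xi> - a\<bar> \<le> e"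
  using real_mean_value[OF DERIV_diff[OF deriv[OF assms(1,3)] deriv[OF assms(2,3)]], of u u'] by blast

lemma k_cross:
  assumes "s \<in> {0..1}" "s' \<in> {0..1}" "t \<in> {0..1}" "\<bar>u\<bar> \<le> R" "\<bar>u'\<bar> \<le> R"
  shows "\<bar>\<kappa> s t u - \<kappa> s' t u - (\<kappa> s t u' - \<kappa> s' t u')\<bar> \<le> M * \<bar>s - s'\<bar> * \<bar>u - u'\<bar>"
proof -
  obtain \<xi> where x: "\<kappa> s t u - \<kappa> s' t u - (\<kappa> s t u' - \<kappa> s' t u') = (l s t \<xi> - l s' t \<xi>) * (u - u')"
    "\<And>a e. \<bar>u - a\<bar> \<le> e \<Longrightarrow> \<bar>u' - a\<bar> \<le> e \<Longrightarrow> \<bar>\<xi> - a\<bar> \<le> e"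
    using k_cross_mean_value[OF assms(1-3)] by blast
  have "\<bar>l s t \<xi> - l s' t \<xi>\<bar> \<le> M * \<bar>s - s'\<bar>" using x(2)[of 0 R] assms by (intro l_lip_s) auto
  then show ?thesis unfolding x(1) abs_mult by (rule mult_right_mono) simp
qed

lemma k_continuous: "s \<in> {0..1} \<Longrightarrow> continuous_on ({0..1} \<times> {-R..R}) (\<lambda>(t,u). \<kappa> s t u)"
  by (rule continuous_on_lipschitz2[OF M_nonneg]) (auto intro!: k_lip_t k_lip_u)

lemma l_continuous: "s \<in> {0..1} \<Longrightarrow> continuous_on ({0..1} \<times> {-R..R}) (\<lambda>(t,u). l s t u)"
  by (rule continuous_on_lipschitz2[OF M_nonneg]) (auto intro!: l_lip_t l_lip_u)

lemma continuous_on_k: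
  assumes "s \<in> {0..1}" "continuous_on {0..1} x" "\<And>t. t \<in> {0..1} \<Longrightarrow> \<bar>x t\<bar> \<le> R"
  shows "continuous_on {0..1} (\<lambda>t. \<kappa> s t (x t))"
    and "continuous_on {0..1} (\<lambda>t. l s t (x t))"
proof -
  have c: "continuous_on {0..1} (\<lambda>t. (t, x t))" by (intro continuous_intros assms)
  have sub: "(\<lambda>t. (t, x t)) ` {0..1} \<subseteq> {0..1} \<times> {-R..R}" using assms(3) by (force simp: abs_le_iff)
  show "continuous_on {0..1} (\<lambda>t. \<kappa> s t (x t))"
    using continuous_on_compose2[OF k_continuous[OF assms(1)] c sub] by simp
  show "continuous_on {0..1} (\<lambda>t. l s t (x t))"
    using continuous_on_compose2[OF l_continuous[OF assms(1)] c sub] by simp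
qed

text \<open>Measurable x must be allowed: continuity of \<phi> is deduced from its equation, which
  already requires the integral to exist.\<close>

lemma k_integrable:
  assumes s: "s \<in> {0..1}" and x: "x \<in> borel_measurable borel" "\<And>t. \<bar>x t\<bar> \<le> R"
  shows "(\<lambda>t. \<kappa> s t (x t)) integrable_on {0..1}"
proof -
  have R: "0 \<le> R" using x(2)[of 0] by linarith
  \<comment> \<open>Clamping both arguments extends the kernel section continuously to the whole
    plane, so that composing it with the Borel map t \<mapsto> (t, x t) stays Borel.\<close>
  define h where "h y = \<kappa> s (max 0 (min 1 (fst y))) (max (-R) (min R (snd y)))" for y :: "real \<times> real"
  have c: "continuous_on UNIV (\<lambda>y::real \<times> real. (max 0 (min 1 (fst y)), max (-R) (min R (snd y))))"
    by (intro continuous_intros)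
  have "continuous_on UNIV h"
    unfolding h_def using R
    by (intro continuous_on_compose2[OF k_continuous[OF s] c, simplified]) auto
  then have "h \<in> borel_measurable borel" by (rule borel_measurable_continuous_onI)
  moreover have "(\<lambda>t. (t, x t)) \<in> borel_measurable borel" using x(1) by (intro borel_measurable_Pair) auto
  ultimately have m: "(\<lambda>t. h (t, x t)) \<in> borel_measurable borel"
    using measurable_comp[of "\<lambda>t. (t, x t)" borel borel h borel] by (simp add: comp_def)
  have eq: "h (t, x t) = \<kappa> s t (x t)" if "t \<in> {0..1}" for t
    using that x(2)[of t] unfolding h_def by (auto simp: max_def min_def)
  have "(\<lambda>t. h (t, x t)) integrable_on {0..1}"
  proof (rule measurable_bounded_by_integrable_imp_integrable)
    have "(\<lambda>t. h (t, x t)) \<in> borel_measurable lebesgue" using m by (simp add: measurable_completion)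
    then show "(\<lambda>t. h (t, x t)) \<in> borel_measurable (lebesgue_on {0..1})" by (rule measurable_restrict_space1)
    show "(\<lambda>t. M) integrable_on {0..1::real}" by (rule integrable_const_ivl)
    show "norm (h (t, x t)) \<le> M" if "t \<in> {0..1}" for t
      using eq[OF that] k_bound[OF s that x(2)] by simp
  qed auto
  then show ?thesis using eq integrable_cong[of "{0..1}" "\<lambda>t. h (t, x t)" "\<lambda>t. \<kappa> s t (x t)"] by blast
qed

lemma integral_lipschitz:
  assumes s: "s \<in> {0..1}" "s' \<in> {0..1}" and x: "x \<in> borel_measurable borel" "\<And>t. \<bar>x t\<bar> \<le> R"
  shows "\<bar>integral {0..1} (\<lambda>t. \<kappa> s t (x t)) - integral {0..1} (\<lambda>t. \<kappa> s' t (x t))\<bar> \<le> M * \<bar>s - s'\<bar>"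
proof -
  note i = k_integrable[OF s(1) x] k_integrable[OF s(2) x]
  have "norm (integral {0..1} (\<lambda>t. \<kappa> s t (x t) - \<kappa> s' t (x t))) \<le> integral {0..1} (\<lambda>t::real. M * \<bar>s - s'\<bar>)"
    by (rule integral_norm_bound_integral) (use i s x in \<open>auto intro!: integrable_diff k_lip_s\<close>)
  then show ?thesis using i by (simp add: integral_diff)
qed

text \<open>The second difference of the kernel in \<open>s\<close> is quadratically small unless \<open>t\<close> lies
  between the outer points, which happens on a set of measure \<open>2 h\<close> where it is still linearly small.\<close>

lemma integral_second_difference:
  assumes s: "s - h \<in> {0..1}" "s + h \<in> {0..1}" and h: "0 \<le> h"
    and x: "x \<in> borel_measurable borel" "\<And>t. \<bar>x t\<bar> \<le> R"
  defines "K \<equiv> \<lambda>s. integral {0..1} (\<lambda>t. \<kappa> s t (x t))"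
  shows "\<bar>K (s + h) - 2 * K s + K (s - h)\<bar> \<le> 5 * M * h^2"
proof -
  have s0: "s \<in> {0..1}" using s h by auto
  let ?G = "\<lambda>t. \<kappa> (s + h) t (x t) - 2 * \<kappa> s t (x t) + \<kappa> (s - h) t (x t)"
  \<comment> \<open>The integral of this majorant is M h^2 + 2 M h times the strip width 2 h, whence
    the constant 5.\<close>
  let ?H = "\<lambda>t. M * h^2 + 2 * M * h * indicat_real {s - h..s + h} t"
  note i = k_integrable[OF s(1) x] k_integrable[OF s(2) x] k_integrable[OF s0 x]
  have G: "(?G has_integral K (s + h) - 2 * K s + K (s - h)) {0..1}"
    unfolding K_def by (intro has_integral_add has_integral_diff has_integral_mult_right integrable_integral i)
  have "(indicat_real {s - h..s + h} has_integral (2 * h)) {0..1}"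
  proof -
    have "((\<lambda>t. 1) has_integral (2 * h)) {s - h..s + h}"
      using has_integral_const_real[of "1::real" "s - h" "s + h"] h by simp
    then have "((\<lambda>t. if t \<in> {s - h..s + h} then 1 else 0) has_integral (2 * h)) {0..1}"
      using has_integral_restrict[of "{s - h..s + h}" "{0..1}" "\<lambda>_. 1::real" "2 * h"] s by auto
    moreover have "(\<lambda>t. if t \<in> {s - h..s + h} then 1 else 0) = indicat_real {s - h..s + h}"
      by (auto simp: indicator_def)
    ultimately show ?thesis by simp
  qed
  from has_integral_mult_right[OF this, of "2 * M * h"]
  have H: "(?H has_integral M * h^2 + 2 * M * h * (2 * h)) {0..1}"
    using has_integral_const_real[of "M * h^2" 0 1] by (intro has_integral_add) simp_all
  have "norm (integral {0..1} ?G) \<le> integral {0..1} ?H"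
  proof (rule integral_norm_bound_integral)
    show "?G integrable_on {0..1}" "?H integrable_on {0..1}" using G H by blast+
    fix t :: real assume t: "t \<in> {0..1}"
    show "norm (?G t) \<le> ?H t"
    proof (cases "t \<in> {s - h..s + h}")
      case True
      have "\<bar>\<kappa> (s + h) t (x t) - \<kappa> s t (x t)\<bar> \<le> M * \<bar>s + h - s\<bar>" "\<bar>\<kappa> (s - h) t (x t) - \<kappa> s t (x t)\<bar> \<le> M * \<bar>s - h - s\<bar>"
        by (intro k_lip_s s s0 t x)+
      moreover have "0 \<le> M * h^2" using M_nonneg by simp
      ultimately show ?thesis using True h by simp
    next
      case False
      then have "\<bar>?G t\<bar> \<le> M * h^2" using h by (intro k_second_s s t x) auto
      then show ?thesis using False by simp
    qed
  qed
  then have "\<bar>K (s + h) - 2 * K s + K (s - h)\<bar> \<le> M * h^2 + 2 * M * h * (2 * h)"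
    using G H by (simp add: integral_unique)
  then show ?thesis by (simp add: power2_eq_square algebra_simps)
qed

text \<open>\<open>KN\<close> and \<open>KT\<close> are \<open>Knys\<close> and \<open>Ktil\<close> at the level of plain functions, where \<open>Q\<close> is replaced by its formula.\<close>

definition KN :: "nat \<Rightarrow> (real \<Rightarrow> real) \<Rightarrow> real \<Rightarrow> real" where
  "KN m x s = quad m (\<lambda>t. \<kappa> s t (x t))"

definition KT :: "nat \<Rightarrow> nat \<Rightarrow> (real \<Rightarrow> real) \<Rightarrow> real \<Rightarrow> real" where
  "KT n p x s = Qform n p (KN (n*p) x) s + KN (n*p) (Qform n p x) s - Qform n p (KN (n*p) (Qform n p x)) s"

lemma KN_bound:
  assumes "m \<ge> 1" "s \<in> {0..1}" "\<And>t. t \<in> {0..1} \<Longrightarrow> \<bar>x t\<bar> \<le> R"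
  shows "\<bar>KN m x s\<bar> \<le> M"
  unfolding KN_def using assms by (intro quad_bound k_bound)

lemma KN_lipschitz:
  assumes "m \<ge> 1" "s \<in> {0..1}" "s' \<in> {0..1}" "\<And>t. t \<in> {0..1} \<Longrightarrow> \<bar>x t\<bar> \<le> R"
  shows "\<bar>KN m x s - KN m x s'\<bar> \<le> M * \<bar>s - s'\<bar>"
  unfolding KN_def quad_diff[symmetric] using assms by (intro quad_bound k_lip_s)

lemma KN_diff_bound:
  assumes "m \<ge> 1" "s \<in> {0..1}" "\<And>t. t \<in> {0..1} \<Longrightarrow> \<bar>x t\<bar> \<le> R" "\<And>t. t \<in> {0..1} \<Longrightarrow> \<bar>y t\<bar> \<le> R"
    "\<And>t. t \<in> {0..1} \<Longrightarrow> \<bar>x t - y t\<bar> \<le> E"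
  shows "\<bar>KN m x s - KN m y s\<bar> \<le> M * E"
  unfolding KN_def quad_diff[symmetric]
proof (rule quad_bound[OF assms(1)])
  fix t :: real assume t: "t \<in> {0..1}"
  have "\<bar>\<kappa> s t (x t) - \<kappa> s t (y t)\<bar> \<le> M * \<bar>x t - y t\<bar>" using assms t by (intro k_lip_u) auto
  also have "\<dots> \<le> M * E" using assms t M_nonneg by (intro mult_left_mono) auto
  finally show "\<bar>\<kappa> s t (x t) - \<kappa> s t (y t)\<bar> \<le> M * E" .
qed

text \<open>The factor E in the constant is what keeps the increments equi-Lipschitz after division
  by the error norm.\<close>

lemma KN_diff_lipschitz:
  assumes "m \<ge> 1" "s \<in> {0..1}" "s' \<in> {0..1}" "\<And>t. t \<in> {0..1} \<Longrightarrow> \<bar>x t\<bar> \<le> R" "\<And>t. t \<in> {0..1} \<Longrightarrow> \<bar>y t\<bar> \<le> R"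
    "\<And>t. t \<in> {0..1} \<Longrightarrow> \<bar>x t - y t\<bar> \<le> E"
  shows "\<bar>(KN m x s - KN m y s) - (KN m x s' - KN m y s')\<bar> \<le> M * E * \<bar>s - s'\<bar>"
  unfolding KN_def quad_diff[symmetric]
proof (rule quad_bound[OF assms(1)])
  fix t :: real assume t: "t \<in> {0..1}"
  have "\<bar>\<kappa> s t (x t) - \<kappa> s' t (x t) - (\<kappa> s t (y t) - \<kappa> s' t (y t))\<bar> \<le> M * \<bar>s - s'\<bar> * \<bar>x t - y t\<bar>"
    using assms t by (intro k_cross) auto
  also have "\<dots> \<le> M * \<bar>s - s'\<bar> * E" using assms t M_nonneg by (intro mult_left_mono) auto
  finally show "\<bar>\<kappa> s t (x t) - \<kappa> s t (y t) - (\<kappa> s' t (x t) - \<kappa> s' t (y t))\<bar> \<le> M * E * \<bar>s - s'\<bar>"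
    by (simp add: algebra_simps)
qed

lemma KN_linearize:
  assumes "m \<ge> 1" "s \<in> {0..1}" "\<And>t. t \<in> {0..1} \<Longrightarrow> \<bar>x t\<bar> \<le> R" "\<And>t. t \<in> {0..1} \<Longrightarrow> \<bar>y t\<bar> \<le> R"
    "\<And>t. t \<in> {0..1} \<Longrightarrow> \<bar>x t - y t\<bar> \<le> E"
  shows "\<bar>KN m x s - KN m y s - quad m (\<lambda>t. l s t (y t) * (x t - y t))\<bar> \<le> M * E^2"
  unfolding KN_def quad_diff[symmetric]
proof (rule quad_bound[OF assms(1)])
  fix t :: real assume t: "t \<in> {0..1}"
  have "\<bar>\<kappa> s t (x t) - \<kappa> s t (y t) - l s t (y t) * (x t - y t)\<bar> \<le> M * (x t - y t)^2"
    using assms t by (intro k_linearize) auto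
  also have "\<dots> \<le> M * E^2" using assms(5)[OF t] M_nonneg
    by (intro mult_left_mono abs_le_square_iff[THEN iffD1]) auto
  finally show "\<bar>\<kappa> s t (x t) - \<kappa> s t (y t) - l s t (y t) * (x t - y t)\<bar> \<le> M * E^2" .
qed

lemma KN_consistent:
  assumes m: "m \<ge> 1" and s: "s \<in> {0..1}" and x: "\<And>t. t \<in> {0..1} \<Longrightarrow> \<bar>x t\<bar> \<le> R" and L: "0 \<le> L"
    and lip: "\<And>t t'. t \<in> {0..1} \<Longrightarrow> t' \<in> {0..1} \<Longrightarrow> \<bar>x t - x t'\<bar> \<le> L * \<bar>t - t'\<bar>"
    and sd: "\<And>t h. t - h \<in> {0..1} \<Longrightarrow> t + h \<in> {0..1} \<Longrightarrow> \<bar>x (t + h) - 2 * x t + x (t - h)\<bar> \<le> L * h^2"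
  shows "\<bar>KN m x s - integral {0..1} (\<lambda>t. \<kappa> s t (x t))\<bar> \<le> 2 * (M * (1 + L + 2 * L^2)) * (1 / real m)^2"
proof -
  \<comment> \<open>In \<open>k_second_t\<close> the term h^2 gives 1, the two squared increments of
    x give 2 L^2, and the second difference of x gives L. The same constant dominates the Lipschitz
    constant M (1 + L) of the integrand.\<close>
  let ?C = "M * (1 + L + 2 * L^2)"
  have C: "0 \<le> ?C" using M_nonneg L by simp
  have sec: "\<bar>\<kappa> s (t + h) (x (t + h)) - 2 * \<kappa> s t (x t) + \<kappa> s (t - h) (x (t - h))\<bar> \<le> ?C * h^2"
    if th: "t - h \<in> {0..1}" "t + h \<in> {0..1}" "(s \<le> t - h \<and> s \<le> t + h) \<or> (t - h \<le> s \<and> t + h \<le> s)" for t h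
  proof -
    have t: "t \<in> {0..1}" using th by auto
    have "\<bar>x (t + h) - x t\<bar> \<le> \<bar>L * h\<bar>" "\<bar>x (t - h) - x t\<bar> \<le> \<bar>L * h\<bar>"
      using lip[OF th(2) t] lip[OF th(1) t] L by (auto simp: abs_mult)
    then have "(x (t + h) - x t)^2 \<le> L^2 * h^2" "(x (t - h) - x t)^2 \<le> L^2 * h^2"
      by (simp_all add: abs_le_square_iff power_mult_distrib)
    then have "h^2 + (x (t + h) - x t)^2 + (x (t - h) - x t)^2 + \<bar>x (t + h) - 2 * x t + x (t - h)\<bar>
       \<le> (1 + L + 2 * L^2) * h^2"
      using sd[OF th(1,2)] by (simp add: algebra_simps)
    then have "M * (h^2 + (x (t + h) - x t)^2 + (x (t - h) - x t)^2 + \<bar>x (t + h) - 2 * x t + x (t - h)\<bar>)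
       \<le> M * ((1 + L + 2 * L^2) * h^2)" using M_nonneg by (rule mult_left_mono)
    then show ?thesis
      using k_second_t[OF th(1,2) s x[OF th(2)] x[OF t] x[OF th(1)] th(3)] by (simp add: mult.assoc)
  qed
  have "\<bar>integral {0..1} (\<lambda>t. \<kappa> s t (x t)) - quad m (\<lambda>t. \<kappa> s t (x t))\<bar> \<le> 2 * ?C * (1 / real m)^2"
  proof (rule quad_error_kink[OF m C, where s=s])
    fix t t' :: real assume t: "t \<in> {0..1}" "t' \<in> {0..1}"
    have "\<bar>\<kappa> s t (x t) - \<kappa> s t' (x t)\<bar> \<le> M * \<bar>t - t'\<bar>" using s t x by (intro k_lip_t) auto
    moreover have "\<bar>\<kappa> s t' (x t) - \<kappa> s t' (x t')\<bar> \<le> M * \<bar>x t - x t'\<bar>" using s t x by (intro k_lip_u) auto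
    moreover have "M * \<bar>x t - x t'\<bar> \<le> M * (L * \<bar>t - t'\<bar>)" using lip t M_nonneg by (intro mult_left_mono) auto
    ultimately have "\<bar>\<kappa> s t (x t) - \<kappa> s t' (x t')\<bar> \<le> M * ((1 + L) * \<bar>t - t'\<bar>)" by (simp add: algebra_simps)
    also have "\<dots> \<le> M * ((1 + L + 2 * L^2) * \<bar>t - t'\<bar>)"
      using M_nonneg by (intro mult_left_mono mult_right_mono) auto
    finally show "\<bar>\<kappa> s t (x t) - \<kappa> s t' (x t')\<bar> \<le> ?C * \<bar>t - t'\<bar>" by (simp add: mult.assoc)
  qed (use s in \<open>auto intro!: sec\<close>)
  then show ?thesis by (simp add: KN_def abs_minus_commute)
qed

text \<open>\<open>x - Qform x\<close> has mean zero over each cell, so away from the cell of \<open>s\<close> and \<open>s'\<close> the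
  linearized kernel difference may be frozen at one point of the cell; the diagonal cell has measure
  \<open>1/n\<close>, and there the crude bound suffices.\<close>

lemma KN_Qform_cell_oscillation:
  assumes n: "n \<ge> 1" and p: "p \<ge> 1" and j: "j \<in> {1..n}"
    and s: "(real j - 1) / real n \<le> s" "s \<le> real j / real n" "(real j - 1) / real n \<le> s'" "s' \<le> real j / real n"
    and x: "\<And>t. t \<in> {0..1} \<Longrightarrow> \<bar>x t\<bar> \<le> R" and L: "0 \<le> L"
    and lip: "\<And>t t'. t \<in> {0..1} \<Longrightarrow> t' \<in> {0..1} \<Longrightarrow> \<bar>x t - x t'\<bar> \<le> L * \<bar>t - t'\<bar>"
  defines "g \<equiv> \<lambda>s. KN (n*p) x s - KN (n*p) (Qform n p x) s"
  shows "\<bar>g s - g s'\<bar> \<le> M * (2 * L + L^2) * (1 / real n)^3"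
proof -
  let ?h = "1 / real n"
  have sI: "s \<in> {0..1}" "s' \<in> {0..1}" using cell_subset_unit[OF j] s by auto
  have ss: "\<bar>s - s'\<bar> \<le> ?h" using s by (rule cell_dist)
  define G where "G t = \<kappa> s t (x t) - \<kappa> s' t (x t) - (\<kappa> s t (Qform n p x t) - \<kappa> s' t (Qform n p x t))" for t
  have "g s - g s' = quad (n*p) G"
    unfolding g_def KN_def G_def quad_diff by simp
  also have "\<dots> = (\<Sum>i=1..n. cell_avg n p i G) / real n" by (rule quad_eq_cells[OF p])
  finally have gG: "g s - g s' = (\<Sum>i=1..n. cell_avg n p i G) / real n" .
  \<comment> \<open>Off the diagonal there are three factors of order 1/n: |s - s'|, the variation
    within the cell, and x - q. The diagonal cell lacks the middle one, but it is a single term, and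
    the sum is divided by n.\<close>
  have cell: "\<bar>cell_avg n p i G\<bar> \<le> M * (1 + L) * L * ?h^3 + (if i = j then M * L * ?h^2 else 0)"
    if i: "i \<in> {1..n}" for i
  proof -
    have i1: "i \<ge> 1" using i by auto
    let ?lo = "(real i - 1) / real n" and ?c = "real i / real n"
    define q where "q = cell_avg n p i x"
    have loc: "?lo \<le> ?c" by (simp add: divide_right_mono)
    have cI: "?c \<in> {0..1}" using i by auto
    have inI: "t \<in> {0..1}" if "?lo < t" "t < ?c" for t using cell_subset_unit[OF i] that by auto
    have Qq: "Qform n p x t = q" if "?lo < t" "t < ?c" for t
      using pidx_eqI[OF n i1, of t] that by (simp add: Qform_cell_avg q_def)
    have lipc: "\<bar>x t - x t'\<bar> \<le> L * ?h" if "?lo \<le> t" "t \<le> ?c" "?lo \<le> t'" "t' \<le> ?c" for t t'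
    proof -
      have "\<bar>x t - x t'\<bar> \<le> L * \<bar>t - t'\<bar>" using lip cell_subset_unit[OF i] that by auto
      also have "\<dots> \<le> L * ?h" using that L by (intro mult_left_mono cell_dist[of i]) auto
      finally show ?thesis .
    qed
    have qdev: "\<bar>q - x t\<bar> \<le> L * ?h" if "?lo \<le> t" "t \<le> ?c" for t
      unfolding q_def by (rule cell_avg_dev[OF n p i1]) (use that lipc in auto)
    have qR: "\<bar>q\<bar> \<le> R" unfolding q_def by (rule cell_avg_bound[OF n p i1]) (use inI x in auto)
    show ?thesis
    proof (cases "i = j")
      case True
      have "\<bar>cell_avg n p i G\<bar> \<le> M * L * ?h^2"
      proof (rule cell_avg_bound[OF n p i1])
        fix t assume t: "?lo < t" "t < ?c"
        have "\<bar>G t\<bar> \<le> M * \<bar>s - s'\<bar> * \<bar>x t - q\<bar>"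
          unfolding G_def Qq[OF t] using sI inI[OF t] x qR by (intro k_cross) auto
        also have "\<dots> \<le> M * ?h * (L * ?h)"
          using M_nonneg ss qdev[of t] t by (intro mult_mono) (auto simp: abs_minus_commute)
        finally show "\<bar>G t\<bar> \<le> M * L * ?h^2" by (simp add: power2_eq_square algebra_simps)
      qed
      moreover have "0 \<le> M * (1 + L) * L * ?h^3" using M_nonneg L by simp
      ultimately show ?thesis using True by simp
    next
      case False
      define a where "a = l s ?c (x ?c) - l s' ?c (x ?c)"
      \<comment> \<open>Both s and s' lie in cell j, so a different cell i is entirely on one side
        of both. This is the side condition of \<open>l_mixed\<close>.\<close>
      have side: "(?c \<le> s \<and> ?c \<le> s') \<or> (s \<le> ?lo \<and> s' \<le> ?lo)"
      proof (cases "i < j")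
        case True
        then have "real i \<le> real j - 1" by linarith
        then have "?c \<le> (real j - 1) / real n" by (rule divide_right_mono) simp
        then show ?thesis using s by linarith
      next
        case F: False
        then have "real j \<le> real i - 1" using False by linarith
        then have "real j / real n \<le> ?lo" by (rule divide_right_mono) simp
        then show ?thesis using s by linarith
      qed
      have "\<bar>cell_avg n p i (\<lambda>t. G t - a * (x t - q))\<bar> \<le> M * (1 + L) * L * ?h^3"
      proof (rule cell_avg_bound[OF n p i1])
        fix t assume t: "?lo < t" "t < ?c"
        note tI = inI[OF t]
        obtain \<xi> where xi: "G t = (l s t \<xi> - l s' t \<xi>) * (x t - q)"
          "\<And>a e. \<bar>x t - a\<bar> \<le> e \<Longrightarrow> \<bar>q - a\<bar> \<le> e \<Longrightarrow> \<bar>\<xi> - a\<bar> \<le> e"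
          using k_cross_mean_value[OF sI tI, of "x t" q] unfolding G_def Qq[OF t] by blast
        have xiR: "\<bar>\<xi>\<bar> \<le> R" using xi(2)[of 0 R] x[OF tI] qR by simp
        have xic: "\<bar>\<xi> - x ?c\<bar> \<le> L * ?h" using lipc[of t ?c] qdev[of ?c] t loc by (intro xi(2)) auto
        have tc: "\<bar>t - ?c\<bar> \<le> ?h" using t loc by (intro cell_dist[of i]) auto
        have "\<bar>l s t \<xi> - l s' t \<xi> - l s ?c (x ?c) + l s' ?c (x ?c)\<bar> \<le> M * \<bar>s - s'\<bar> * (\<bar>t - ?c\<bar> + \<bar>\<xi> - x ?c\<bar>)"
          using sI tI cI xiR x[OF cI] side t by (intro l_mixed) auto
        also have "\<dots> \<le> M * ?h * (?h + L * ?h)"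
          using M_nonneg ss tc xic by (intro mult_mono add_mono) auto
        finally have "\<bar>l s t \<xi> - l s' t \<xi> - a\<bar> \<le> M * ?h * (?h + L * ?h)" by (simp add: a_def algebra_simps)
        then have "\<bar>l s t \<xi> - l s' t \<xi> - a\<bar> * \<bar>x t - q\<bar> \<le> (M * ?h * (?h + L * ?h)) * (L * ?h)"
          using qdev[of t] t M_nonneg L by (intro mult_mono) (auto simp: abs_minus_commute)
        moreover have "G t - a * (x t - q) = (l s t \<xi> - l s' t \<xi> - a) * (x t - q)"
          unfolding xi(1) by (simp add: algebra_simps)
        ultimately show "\<bar>G t - a * (x t - q)\<bar> \<le> M * (1 + L) * L * ?h^3"
          by (simp only: abs_mult power3_eq_cube) (simp add: algebra_simps add_divide_distrib)
      qed
      moreover have "cell_avg n p i (\<lambda>t. G t - a * (x t - q)) = cell_avg n p i G"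
        by (simp add: cell_avg_diff cell_avg_cmult cell_avg_const[OF p] q_def)
      ultimately show ?thesis using False by simp
    qed
  qed
  have "\<bar>\<Sum>i=1..n. cell_avg n p i G\<bar> \<le> (\<Sum>i=1..n. M * (1 + L) * L * ?h^3 + (if i = j then M * L * ?h^2 else 0))"
    by (rule order_trans[OF sum_abs sum_mono[OF cell]])
  also have "\<dots> = real n * (M * (1 + L) * L * ?h^3) + M * L * ?h^2"
    using j by (simp add: sum.distrib)
  finally have "\<bar>g s - g s'\<bar> \<le> (real n * (M * (1 + L) * L * ?h^3) + M * L * ?h^2) / real n"
    unfolding gG using n by (simp add: divide_right_mono)
  also have "\<dots> = M * (2 * L + L^2) * ?h^3" using n by (simp add: field_simps power2_eq_square power3_eq_cube)
  finally show ?thesis .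
qed

lemma KT_consistent:
  assumes n: "n \<ge> 1" and p: "p \<ge> 1" and s: "s \<in> {0..1}" and x: "\<And>t. t \<in> {0..1} \<Longrightarrow> \<bar>x t\<bar> \<le> R" and L: "0 \<le> L"
    and lip: "\<And>t t'. t \<in> {0..1} \<Longrightarrow> t' \<in> {0..1} \<Longrightarrow> \<bar>x t - x t'\<bar> \<le> L * \<bar>t - t'\<bar>"
    and sd: "\<And>t h. t - h \<in> {0..1} \<Longrightarrow> t + h \<in> {0..1} \<Longrightarrow> \<bar>x (t + h) - 2 * x t + x (t - h)\<bar> \<le> L * h^2"
  shows "\<bar>KT n p x s - integral {0..1} (\<lambda>t. \<kappa> s t (x t))\<bar>
    \<le> M * (2 + 4 * L + 5 * L^2) * max ((1 / (real n * real p))^2) ((1 / real n)^3)" (is "_ \<le> _ * ?m")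
proof -
  define g where "g s = KN (n*p) x s - KN (n*p) (Qform n p x) s" for s
  note P = pidx_in_cell[OF n s]
  \<comment> \<open>The projection error at s is an average of g t - g s over the cell of s, so only
    the oscillation of g inside one cell counts.\<close>
  have "\<bar>Qform n p g s - g s\<bar> \<le> M * (2 * L + L^2) * (1 / real n)^3"
    unfolding Qform_cell_avg
  proof (rule cell_avg_dev[OF n p])
    fix t assume "(real (pidx n s) - 1) / real n < t" "t < real (pidx n s) / real n"
    then show "\<bar>g t - g s\<bar> \<le> M * (2 * L + L^2) * (1 / real n)^3"
      unfolding g_def using P x L lip n p by (intro KN_Qform_cell_oscillation[where j="pidx n s"]) auto
  qed (use P in auto)
  also have "\<dots> \<le> M * (2 * L + L^2) * ?m"
    using M_nonneg L by (intro mult_left_mono) auto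
  finally have 1: "\<bar>Qform n p g s - g s\<bar> \<le> M * (2 * L + L^2) * ?m" .
  have "\<bar>KN (n*p) x s - integral {0..1} (\<lambda>t. \<kappa> s t (x t))\<bar> \<le> 2 * (M * (1 + L + 2 * L^2)) * (1 / real (n*p))^2"
    using n p s x L lip sd by (intro KN_consistent) auto
  also have "\<dots> \<le> 2 * (M * (1 + L + 2 * L^2)) * ?m"
    using M_nonneg L by (intro mult_left_mono) auto
  finally have 2: "\<bar>KN (n*p) x s - integral {0..1} (\<lambda>t. \<kappa> s t (x t))\<bar> \<le> 2 * (M * (1 + L + 2 * L^2)) * ?m" .
  \<comment> \<open>The modified operator is the Nystroem operator plus a projection error of the
    difference g, instead of one of the full image.\<close>
  have "KT n p x s = KN (n*p) x s + (Qform n p g s - g s)"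
    unfolding KT_def g_def Qform_diff by simp
  then have "\<bar>KT n p x s - integral {0..1} (\<lambda>t. \<kappa> s t (x t))\<bar>
      \<le> 2 * (M * (1 + L + 2 * L^2)) * ?m + M * (2 * L + L^2) * ?m"
    using 1 2 by linarith
  also have "\<dots> = M * (2 + 4 * L + 5 * L^2) * ?m" by (simp add: algebra_simps)
  finally show ?thesis .
qed

end

section \<open>Compactness\<close>

text \<open>A second difference of f is the sum of two first-order Taylor remainders, each at most
  |B2| h^2; together with the Lipschitz bound B1 this explains the choice of F.\<close>

lemma C2_01_bounds:
  assumes "C2_01 f"
  shows "\<exists>F\<ge>0. (\<forall>s\<in>{0..1}. \<forall>s'\<in>{0..1}. \<bar>f s - f s'\<bar> \<le> F * \<bar>s - s'\<bar>) \<and>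
    (\<forall>s h. s - h \<in> {0..1} \<longrightarrow> s + h \<in> {0..1} \<longrightarrow> \<bar>f (s + h) - 2 * f s + f (s - h)\<bar> \<le> F * h^2)"
proof -
  obtain f' f'' where
    f': "\<And>t. t \<in> {0..1} \<Longrightarrow> (f has_real_derivative f' t) (at t within {0..1})"
    and f'': "\<And>t. t \<in> {0..1} \<Longrightarrow> (f' has_real_derivative f'' t) (at t within {0..1})"
    and c: "continuous_on {0..1} f''"
    using assms unfolding C2_01_def by blast
  have c': "continuous_on {0..1} f'" using f'' by (rule DERIV_continuous_on)
  obtain B1 where B1: "\<And>x. x \<in> {0..1} \<Longrightarrow> norm (f' x) \<le> B1"
    using compact_imp_bounded[OF compact_continuous_image[OF c' compact_Icc]] unfolding bounded_iff by blast
  obtain B2 where B2: "\<And>x. x \<in> {0..1} \<Longrightarrow> norm (f'' x) \<le> B2"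
    using compact_imp_bounded[OF compact_continuous_image[OF c compact_Icc]] unfolding bounded_iff by blast
  define F where "F = \<bar>B1\<bar> + 2 * \<bar>B2\<bar>"
  have lip: "\<bar>f s - f s'\<bar> \<le> F * \<bar>s - s'\<bar>" if "s \<in> {0..1}" "s' \<in> {0..1}" for s s'
  proof -
    have "norm (f s - f s') \<le> F * norm (s - s')"
    proof (rule field_differentiable_bound[OF _ f'])
      show "norm (f' z) \<le> F" if "z \<in> {0..1}" for z using B1[OF that] unfolding F_def by linarith
    qed (use that in auto)
    then show ?thesis by simp
  qed
  have lip': "\<bar>f' s - f' s'\<bar> \<le> \<bar>B2\<bar> * \<bar>s - s'\<bar>" if "s \<in> {0..1}" "s' \<in> {0..1}" for s s'
  proof -
    have "norm (f' s - f' s') \<le> \<bar>B2\<bar> * norm (s - s')"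
    proof (rule field_differentiable_bound[OF _ f''])
      show "norm (f'' z) \<le> \<bar>B2\<bar>" if "z \<in> {0..1}" for z using B2[OF that] by linarith
    qed (use that in auto)
    then show ?thesis by simp
  qed
  have taylor: "\<bar>f y - f x - (y - x) * f' x\<bar> \<le> \<bar>B2\<bar> * (y - x)^2" if xy: "x \<in> {0..1}" "y \<in> {0..1}" for x y
  proof -
    have sub: "closed_segment x y \<subseteq> {0..1}" using xy by (intro closed_segment_subset) auto
    have "norm (f y - f x - (y - x) *\<^sub>R f' x) \<le> norm (y - x) * (\<bar>B2\<bar> * \<bar>y - x\<bar>)"
    proof (rule vector_differentiable_bound_linearization[where S="closed_segment x y" and f'=f' and ?x0.0=x])
      fix w assume w: "w \<in> closed_segment x y"
      show "(f has_vector_derivative f' w) (at w within closed_segment x y)"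
        using DERIV_subset[OF f' sub] sub w by (auto simp: has_real_derivative_iff_has_vector_derivative)
      have "\<bar>f' w - f' x\<bar> \<le> \<bar>B2\<bar> * \<bar>w - x\<bar>" using lip' w sub xy by blast
      also have "\<dots> \<le> \<bar>B2\<bar> * \<bar>y - x\<bar>"
        using segment_bound(1)[OF w] by (intro mult_left_mono) (auto simp: abs_minus_commute)
      finally show "norm (f' w - f' x) \<le> \<bar>B2\<bar> * \<bar>y - x\<bar>" by simp
    qed auto
    then show ?thesis by (simp add: power2_eq_square abs_mult_self_eq algebra_simps)
  qed
  have sd: "\<bar>f (s + h) - 2 * f s + f (s - h)\<bar> \<le> F * h^2" if sh: "s - h \<in> {0..1}" "s + h \<in> {0..1}" for s h
  proof -
    have s: "s \<in> {0..1}" using sh by auto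
    have "\<bar>f (s + h) - 2 * f s + f (s - h)\<bar> \<le> \<bar>B2\<bar> * h^2 + \<bar>B2\<bar> * h^2"
      using taylor[OF s sh(1)] taylor[OF s sh(2)] by simp
    also have "\<dots> \<le> F * h^2" unfolding F_def by (simp add: algebra_simps)
    finally show ?thesis .
  qed
  show ?thesis
    by (rule exI[of _ F]) (use lip sd in \<open>auto simp: F_def\<close>)
qed

text \<open>Carries a limit found for the Lipschitz sequence W over to the possibly discontinuous
  sequence x.\<close>

lemma uniform_limit_perturb:
  fixes x W :: "'k \<Rightarrow> 'a \<Rightarrow> real"
  assumes W: "uniform_limit S W g F" and B: "(B \<longlongrightarrow> 0) F"
    and d: "\<forall>\<^sub>F k in F. \<forall>s\<in>S. \<bar>x k s - W k s\<bar> \<le> B k"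
  shows "uniform_limit S x g F"
proof (rule uniform_limitI)
  fix e :: real assume e: "e > 0"
  then have "\<forall>\<^sub>F k in F. \<forall>s\<in>S. dist (W k s) (g s) < e/2" using uniform_limitD[OF W, of "e/2"] by simp
  moreover have "\<forall>\<^sub>F k in F. B k < e/2" using order_tendstoD(2)[OF B, of "e/2"] e by simp
  ultimately show "\<forall>\<^sub>F k in F. \<forall>s\<in>S. dist (x k s) (g s) < e"
    using d
  proof eventually_elim
    case (elim k)
    show ?case
    proof
      fix s assume s: "s \<in> S"
      then have "\<bar>W k s - g s\<bar> < e/2" "\<bar>x k s - W k s\<bar> \<le> B k" using elim by (auto simp: dist_real_def)
      then show "dist (x k s) (g s) < e" using elim(2) unfolding dist_real_def by linarith
    qed
  qed
qed

text \<open>The rule does not enlarge sup bounds, so the integrand may vary together with the number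
  of panels.\<close>

lemma quad_tendsto_uniform:
  assumes m: "filterlim m at_top sequentially" and m1: "\<And>k. m k \<ge> 1"
    and g: "continuous_on {0..1} g" and u: "uniform_limit {0..1} G g sequentially"
  shows "(\<lambda>k. quad (m k) (G k)) \<longlonglongrightarrow> integral {0..1} g"
proof -
  have 1: "(\<lambda>k. quad (m k) g) \<longlonglongrightarrow> integral {0..1} g"
    using filterlim_compose[OF quad_tendsto_integral[OF g] m] .
  have "(\<lambda>k. quad (m k) (G k) - quad (m k) g) \<longlonglongrightarrow> 0"
  proof (rule tendstoI)
    fix e :: real assume e: "e > 0"
    have "\<forall>\<^sub>F k in sequentially. \<forall>s\<in>{0..1}. dist (G k s) (g s) < e/2" using uniform_limitD[OF u, of "e/2"] e by simp
    then show "\<forall>\<^sub>F k in sequentially. dist (quad (m k) (G k) - quad (m k) g) 0 < e"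
    proof eventually_elim
      case (elim k)
      have "\<bar>quad (m k) (\<lambda>t. G k t - g t)\<bar> \<le> e/2"
        using elim m1 by (intro quad_bound) (auto simp: dist_real_def intro: less_imp_le)
      then show ?case using e by (simp add: quad_diff)
    qed
  qed
  from tendsto_add[OF 1 this] show ?thesis by simp
qed

lemma equi_lipschitz_subseq:
  fixes w :: "nat \<Rightarrow> real \<Rightarrow> real"
  assumes B: "0 \<le> B" and b: "\<And>k s. s \<in> {0..1} \<Longrightarrow> \<bar>w k s\<bar> \<le> B"
    and lip: "\<And>k s s'. s \<in> {0..1} \<Longrightarrow> s' \<in> {0..1} \<Longrightarrow> \<bar>w k s - w k s'\<bar> \<le> B * \<bar>s - s'\<bar>"
  obtains g r where "continuous_on {0..1} g" "strict_mono (r :: nat \<Rightarrow> nat)"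
    "uniform_limit {0..1} (\<lambda>k. w (r k)) g sequentially"
proof -
  obtain g and r :: "nat \<Rightarrow> nat" where gr: "continuous_on {0..1} g" "strict_mono r"
    "\<And>e. 0 < e \<Longrightarrow> \<exists>N. \<forall>n x. n \<ge> N \<and> x \<in> {0..1} \<longrightarrow> norm (w (r n) x - g x) < e"
  proof (rule Arzela_Ascoli[of "{0..1}" w B])
    show "norm (w n x) \<le> B" if "x \<in> {0..1}" for n x using b[OF that] by simp
    fix x e :: real assume xe: "x \<in> {0..1}" "0 < e"
    show "\<exists>d>0. \<forall>n y. y \<in> {0..1} \<and> norm (x - y) < d \<longrightarrow> norm (w n x - w n y) < e"
    \<comment> \<open>The summand 1 avoids division by zero when B = 0.\<close>
    proof (intro exI[of _ "e / (B + 1)"] conjI allI impI)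
      show "0 < e / (B + 1)" using xe B by simp
      fix n y assume y: "y \<in> {0..1} \<and> norm (x - y) < e / (B + 1)"
      have "\<bar>w n x - w n y\<bar> \<le> B * \<bar>x - y\<bar>" using lip xe y by blast
      also have "\<dots> \<le> (B + 1) * \<bar>x - y\<bar>" by (intro mult_right_mono) auto
      also have "\<dots> < e" using y B by (simp add: field_simps)
      finally show "norm (w n x - w n y) < e" by simp
    qed
  qed auto
  have "uniform_limit {0..1} (\<lambda>k. w (r k)) g sequentially"
    unfolding uniform_limit_sequentially_iff dist_norm using gr(3) by meson
  with gr show ?thesis by (intro that)
qed

lemma inverse_filterlim_0:
  assumes "filterlim (n :: nat \<Rightarrow> nat) at_top sequentially"
  shows "(\<lambda>k. c * (1 / real (n k))) \<longlonglongrightarrow> 0"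
proof -
  have "(\<lambda>k. 1 / real (n k)) \<longlonglongrightarrow> 0"
    using filterlim_compose[OF lim_1_over_n assms] by simp
  from tendsto_mult_left[OF this, of c] show ?thesis by simp
qed

lemma filterlim_mult_ge_1:
  assumes n: "filterlim (n :: nat \<Rightarrow> nat) at_top sequentially" and p: "\<And>k. p k \<ge> 1"
  shows "filterlim (\<lambda>k. n k * p k) at_top sequentially"
proof (rule filterlim_at_top_mono[OF n])
  show "\<forall>\<^sub>F k in sequentially. n k \<le> n k * p k" using p by (auto intro!: always_eventually)
qed

section \<open>Limits of discrete solutions and of rescaled errors\<close>

context kernel_bounds
begin

text \<open>The difference consists of two projection errors of Nystroem images. Such images are
  Lipschitz with constant M even when x is discontinuous.\<close>

lemma KT_decompose:
  assumes n: "n \<ge> 1" and p: "p \<ge> 1" and s: "s \<in> {0..1}" and x: "\<And>t. t \<in> {0..1} \<Longrightarrow> \<bar>x t\<bar> \<le> R"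
  shows "\<bar>KT n p x s - KN (n*p) x s\<bar> \<le> 2 * M * (1 / real n)"
proof -
  have m: "n * p \<ge> 1" using n p by simp
  have q: "\<bar>Qform n p x t\<bar> \<le> R" if "t \<in> {0..1}" for t using Qform_bound[OF n p that] x by blast
  have "\<bar>Qform n p (KN (n*p) x) s - KN (n*p) x s\<bar> \<le> M * (1 / real n)"
    by (rule Qform_lipschitz_error[OF n p s M_nonneg KN_lipschitz[OF m _ _ x]])
  moreover have "\<bar>Qform n p (KN (n*p) (Qform n p x)) s - KN (n*p) (Qform n p x) s\<bar> \<le> M * (1 / real n)"
    by (rule Qform_lipschitz_error[OF n p s M_nonneg KN_lipschitz[OF m _ _ q]])
  ultimately show ?thesis unfolding KT_def by linarith
qed

text \<open>Projection errors of increments of Nystroem images, with the Lipschitz constant M E. The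
  bound is still O(1/n) after division by E.\<close>

lemma KT_diff_decompose:
  assumes n: "n \<ge> 1" and p: "p \<ge> 1" and s: "s \<in> {0..1}"
    and x: "\<And>t. t \<in> {0..1} \<Longrightarrow> \<bar>x t\<bar> \<le> R" and y: "\<And>t. t \<in> {0..1} \<Longrightarrow> \<bar>y t\<bar> \<le> R"
    and E: "\<And>t. t \<in> {0..1} \<Longrightarrow> \<bar>x t - y t\<bar> \<le> E"
  shows "\<bar>KT n p x s - KT n p y s - (KN (n*p) x s - KN (n*p) y s)\<bar> \<le> 2 * (M * E) * (1 / real n)"
proof -
  have m: "n * p \<ge> 1" using n p by simp
  have E0: "0 \<le> M * E" using E[of 0] M_nonneg by simp
  have qx: "\<bar>Qform n p x t\<bar> \<le> R" if "t \<in> {0..1}" for t using Qform_bound[OF n p that] x by blast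
  have qy: "\<bar>Qform n p y t\<bar> \<le> R" if "t \<in> {0..1}" for t using Qform_bound[OF n p that] y by blast
  have qE: "\<bar>Qform n p x t - Qform n p y t\<bar> \<le> E" if "t \<in> {0..1}" for t
    using Qform_bound[OF n p that, of "\<lambda>t. x t - y t"] E unfolding Qform_diff by blast
  let ?a = "\<lambda>s. KN (n*p) x s - KN (n*p) y s"
  let ?b = "\<lambda>s. KN (n*p) (Qform n p x) s - KN (n*p) (Qform n p y) s"
  have "\<bar>Qform n p ?a s - ?a s\<bar> \<le> M * E * (1 / real n)"
    by (rule Qform_lipschitz_error[OF n p s E0 KN_diff_lipschitz[OF m _ _ x y E]])
  moreover have "\<bar>Qform n p ?b s - ?b s\<bar> \<le> M * E * (1 / real n)"
    by (rule Qform_lipschitz_error[OF n p s E0 KN_diff_lipschitz[OF m _ _ qx qy qE]])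
  ultimately show ?thesis unfolding KT_def Qform_diff by linarith
qed

text \<open>The limit is extracted from the Nystroem images of the x k; \<open>KT_decompose\<close>
  transfers uniform convergence to the x k themselves, and convergence of the quadrature identifies
  the limit equation.\<close>

lemma solutions_subseq_converge:
  fixes x :: "nat \<Rightarrow> real \<Rightarrow> real"
  assumes n: "filterlim n at_top sequentially" "\<And>k. n k \<ge> 1" and p: "\<And>k. p k \<ge> 1"
    and f: "continuous_on {0..1} f"
    and x: "\<And>k t. t \<in> {0..1} \<Longrightarrow> \<bar>x k t\<bar> \<le> R"
    and eq: "\<And>k s. s \<in> {0..1} \<Longrightarrow> x k s = f s + KT (n k) (p k) (x k) s"
  obtains y r where "strict_mono (r :: nat \<Rightarrow> nat)" "uniform_limit {0..1} (\<lambda>k. x (r k)) y sequentially"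
    "continuous_on {0..1} y" "\<And>s. s \<in> {0..1} \<Longrightarrow> y s = f s + integral {0..1} (\<lambda>t. \<kappa> s t (y t))"
proof -
  define m where "m k = n k * p k" for k
  have m: "filterlim m at_top sequentially" unfolding m_def by (rule filterlim_mult_ge_1[OF n(1) p])
  have m1: "m k \<ge> 1" for k using n(2)[of k] p[of k] by (simp add: m_def)
  define w where "w k = KN (m k) (x k)" for k
  obtain g r where g: "continuous_on {0..1} g" and r: "strict_mono (r :: nat \<Rightarrow> nat)"
    and wg: "uniform_limit {0..1} (\<lambda>k. w (r k)) g sequentially"
    by (rule equi_lipschitz_subseq[of M w]) (auto simp: w_def intro!: M_nonneg KN_bound KN_lipschitz m1 x)
  define y where "y s = f s + g s" for s
  have y: "continuous_on {0..1} y" unfolding y_def by (intro continuous_intros f g)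
  have xy: "uniform_limit {0..1} (\<lambda>k. x (r k)) y sequentially"
  proof (rule uniform_limit_perturb)
    show "uniform_limit {0..1} (\<lambda>k s. f s + w (r k) s) y sequentially"
      unfolding y_def by (intro uniform_limit_intros wg)
    have "filterlim (\<lambda>k. n (r k)) at_top sequentially"
      by (rule filterlim_compose[OF n(1) filterlim_subseq[OF r]])
    then show "(\<lambda>k. 2 * M * (1 / real (n (r k)))) \<longlonglongrightarrow> 0" by (rule inverse_filterlim_0)
    show "\<forall>\<^sub>F k in sequentially. \<forall>s\<in>{0..1}. \<bar>x (r k) s - (f s + w (r k) s)\<bar> \<le> 2 * M * (1 / real (n (r k)))"
    proof (intro always_eventually allI ballI)
      fix k and s :: real assume s: "s \<in> {0..1}"
      show "\<bar>x (r k) s - (f s + w (r k) s)\<bar> \<le> 2 * M * (1 / real (n (r k)))"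
        using KT_decompose[OF n(2)[of "r k"] p[of "r k"] s x[of _ "r k"]] eq[OF s, of "r k"] unfolding w_def m_def by simp
    qed
  qed
  \<comment> \<open>The bound passes to the limit, so the kernel estimates may also be used at
    y.\<close>
  have yR: "\<bar>y t\<bar> \<le> R" if "t \<in> {0..1}" for t
    using tendsto_rabs[OF tendsto_uniform_limitI[OF xy that]] x[OF that]
    by (intro Lim_bounded[where M=0]) auto
  have "g s = integral {0..1} (\<lambda>t. \<kappa> s t (y t))" if s: "s \<in> {0..1}" for s
  proof -
    have "uniform_limit {0..1} (\<lambda>k t. \<kappa> s t (x (r k) t)) (\<lambda>t. \<kappa> s t (y t)) sequentially"
    proof (rule uniform_limitI)
      fix e :: real assume e: "e > 0"
      then have "0 < e / (M + 1)" using M_nonneg by simp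
      from uniform_limitD[OF xy this]
      show "\<forall>\<^sub>F k in sequentially. \<forall>t\<in>{0..1}. dist (\<kappa> s t (x (r k) t)) (\<kappa> s t (y t)) < e"
      proof eventually_elim
        case (elim k)
        show ?case
        proof
          fix t :: real assume t: "t \<in> {0..1}"
          have "\<bar>\<kappa> s t (x (r k) t) - \<kappa> s t (y t)\<bar> \<le> M * \<bar>x (r k) t - y t\<bar>" by (intro k_lip_u s t x yR)
          also have "\<dots> \<le> (M + 1) * \<bar>x (r k) t - y t\<bar>" by (intro mult_right_mono) auto
          also have "\<dots> < e" using elim t M_nonneg by (auto simp: dist_real_def field_simps)
          finally show "dist (\<kappa> s t (x (r k) t)) (\<kappa> s t (y t)) < e" by (simp add: dist_real_def)
        qed
      qed
    qed
    then have "(\<lambda>k. quad (m (r k)) (\<lambda>t. \<kappa> s t (x (r k) t))) \<longlonglongrightarrow> integral {0..1} (\<lambda>t. \<kappa> s t (y t))"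
      by (intro quad_tendsto_uniform filterlim_compose[OF m filterlim_subseq[OF r]] m1 continuous_on_k s y yR)
    moreover have "(\<lambda>k. w (r k) s) \<longlonglongrightarrow> g s" using tendsto_uniform_limitI[OF wg s] .
    ultimately show ?thesis unfolding w_def KN_def using LIMSEQ_unique by blast
  qed
  then show ?thesis using y xy r by (intro that[of r y]) (auto simp: y_def)
qed

text \<open>Divided by E, the increments of \<open>KN\<close> are bounded by M and M-Lipschitz, so a
  subsequence converges uniformly; projection errors and residuals vanish relative to E. The
  consistency order enters only through \<epsilon> / E \<longlonglongrightarrow> 0.\<close>

lemma error_subseq_limit:
  fixes x :: "nat \<Rightarrow> real \<Rightarrow> real" and E \<epsilon> :: "nat \<Rightarrow> real"
  assumes n: "filterlim n at_top sequentially" "\<And>k. n k \<ge> 1" and p: "\<And>k. p k \<ge> 1"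
    and x: "\<And>k t. t \<in> {0..1} \<Longrightarrow> \<bar>x k t\<bar> \<le> R"
    and \<phi>: "continuous_on {0..1} \<phi>" "\<And>t. t \<in> {0..1} \<Longrightarrow> \<bar>\<phi> t\<bar> \<le> R"
    and E: "\<And>k. E k > 0" "E \<longlonglongrightarrow> 0" "\<And>k t. t \<in> {0..1} \<Longrightarrow> \<bar>x k t - \<phi> t\<bar> \<le> E k"
    and res: "\<And>k s. s \<in> {0..1} \<Longrightarrow> \<bar>x k s - \<phi> s - (KT (n k) (p k) (x k) s - KT (n k) (p k) \<phi> s)\<bar> \<le> \<epsilon> k"
      "(\<lambda>k. \<epsilon> k / E k) \<longlonglongrightarrow> 0"
  obtains A r where "strict_mono (r :: nat \<Rightarrow> nat)" "continuous_on {0..1} A"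
    "uniform_limit {0..1} (\<lambda>k t. (x (r k) t - \<phi> t) / E (r k)) A sequentially"
    "\<And>s. s \<in> {0..1} \<Longrightarrow> A s = integral {0..1} (\<lambda>t. l s t (\<phi> t) * A t)"
proof -
  define m where "m k = n k * p k" for k
  have m: "filterlim m at_top sequentially" unfolding m_def by (rule filterlim_mult_ge_1[OF n(1) p])
  have m1: "m k \<ge> 1" for k using n(2)[of k] p[of k] by (simp add: m_def)
  define w where "w k s = (KN (m k) (x k) s - KN (m k) \<phi> s) / E k" for k s
  define d where "d k t = (x k t - \<phi> t) / E k" for k t
  have wb: "\<bar>w k s\<bar> \<le> M" if s: "s \<in> {0..1}" for k s
  proof -
    have "\<bar>w k s\<bar> = \<bar>KN (m k) (x k) s - KN (m k) \<phi> s\<bar> / E k" using E(1)[of k] unfolding w_def by simp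
    also have "\<dots> \<le> (M * E k) / E k"
      using KN_diff_bound[OF m1[of k] s x[of _ k] \<phi>(2) E(3)[of _ k]] E(1)[of k] by (intro divide_right_mono) auto
    also have "\<dots> = M" using E(1)[of k] by simp
    finally show ?thesis .
  qed
  have wl: "\<bar>w k s - w k s'\<bar> \<le> M * \<bar>s - s'\<bar>" if s: "s \<in> {0..1}" "s' \<in> {0..1}" for k s s'
  proof -
    have "\<bar>w k s - w k s'\<bar> = \<bar>(KN (m k) (x k) s - KN (m k) \<phi> s) - (KN (m k) (x k) s' - KN (m k) \<phi> s')\<bar> / E k"
      using E(1)[of k] unfolding w_def by (simp add: diff_divide_distrib[symmetric])
    also have "\<dots> \<le> (M * E k * \<bar>s - s'\<bar>) / E k"
      using KN_diff_lipschitz[OF m1[of k] s x[of _ k] \<phi>(2) E(3)[of _ k]] E(1)[of k] by (intro divide_right_mono) auto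
    also have "\<dots> = M * \<bar>s - s'\<bar>" using E(1)[of k] by simp
    finally show ?thesis .
  qed
  obtain A r where A: "continuous_on {0..1} A" and r: "strict_mono (r :: nat \<Rightarrow> nat)"
    and wA: "uniform_limit {0..1} (\<lambda>k. w (r k)) A sequentially"
    by (rule equi_lipschitz_subseq[of M w]) (auto intro!: M_nonneg wb wl)
  have nr: "filterlim (\<lambda>k. n (r k)) at_top sequentially"
    by (rule filterlim_compose[OF n(1) filterlim_subseq[OF r]])
  have Er: "(\<lambda>k. E (r k)) \<longlonglongrightarrow> 0" using LIMSEQ_subseq_LIMSEQ[OF E(2) r] by (simp add: comp_def)
  have er: "(\<lambda>k. \<epsilon> (r k) / E (r k)) \<longlonglongrightarrow> 0" using LIMSEQ_subseq_LIMSEQ[OF res(2) r] by (simp add: comp_def)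
  have dA: "uniform_limit {0..1} (\<lambda>k. d (r k)) A sequentially"
  proof (rule uniform_limit_perturb[OF wA])
    show "(\<lambda>k. 2 * M * (1 / real (n (r k))) + \<epsilon> (r k) / E (r k)) \<longlonglongrightarrow> 0"
      using tendsto_add[OF inverse_filterlim_0[OF nr, of "2 * M"] er] by simp
    show "\<forall>\<^sub>F k in sequentially. \<forall>s\<in>{0..1}. \<bar>d (r k) s - w (r k) s\<bar> \<le> 2 * M * (1 / real (n (r k))) + \<epsilon> (r k) / E (r k)"
    proof (intro always_eventually allI ballI)
      fix k and s :: real assume s: "s \<in> {0..1}"
      let ?k = "r k"
      have "\<bar>x ?k s - \<phi> s - (KN (m ?k) (x ?k) s - KN (m ?k) \<phi> s)\<bar> \<le> 2 * (M * E ?k) * (1 / real (n ?k)) + \<epsilon> ?k"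
        using KT_diff_decompose[of "n ?k" "p ?k" s "x ?k" \<phi> "E ?k", OF n(2) p s x \<phi>(2) E(3)] res(1)[OF s, of ?k]
        unfolding m_def by linarith
      then have "\<bar>x ?k s - \<phi> s - (KN (m ?k) (x ?k) s - KN (m ?k) \<phi> s)\<bar> / E ?k
          \<le> (2 * (M * E ?k) * (1 / real (n ?k)) + \<epsilon> ?k) / E ?k"
        using E(1)[of ?k] by (intro divide_right_mono) auto
      also have "\<dots> = 2 * M * (1 / real (n ?k)) + \<epsilon> ?k / E ?k"
        using E(1)[of ?k] by (simp add: add_divide_distrib)
      finally show "\<bar>d ?k s - w ?k s\<bar> \<le> 2 * M * (1 / real (n ?k)) + \<epsilon> ?k / E ?k"
        using E(1)[of ?k] unfolding d_def w_def by (simp add: diff_divide_distrib[symmetric])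
    qed
  qed
  have "A s = integral {0..1} (\<lambda>t. l s t (\<phi> t) * A t)" if s: "s \<in> {0..1}" for s
  proof -
    have "uniform_limit {0..1} (\<lambda>k t. l s t (\<phi> t) * d (r k) t) (\<lambda>t. l s t (\<phi> t) * A t) sequentially"
    proof (rule uniform_limitI)
      fix e :: real assume e: "e > 0"
      then have "0 < e / (M + 1)" using M_nonneg by simp
      from uniform_limitD[OF dA this]
      show "\<forall>\<^sub>F k in sequentially. \<forall>t\<in>{0..1}. dist (l s t (\<phi> t) * d (r k) t) (l s t (\<phi> t) * A t) < e"
      proof eventually_elim
        case (elim k)
        show ?case
        proof
          fix t :: real assume t: "t \<in> {0..1}"
          have "\<bar>l s t (\<phi> t) * d (r k) t - l s t (\<phi> t) * A t\<bar> = \<bar>l s t (\<phi> t)\<bar> * \<bar>d (r k) t - A t\<bar>"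
            by (simp add: abs_mult[symmetric] algebra_simps)
          also have "\<dots> \<le> (M + 1) * \<bar>d (r k) t - A t\<bar>"
            using l_bound[OF s t \<phi>(2)[OF t]] by (intro mult_right_mono) auto
          also have "\<dots> < e" using elim t M_nonneg by (auto simp: dist_real_def field_simps)
          finally show "dist (l s t (\<phi> t) * d (r k) t) (l s t (\<phi> t) * A t) < e" by (simp add: dist_real_def)
        qed
      qed
    qed
    then have 1: "(\<lambda>k. quad (m (r k)) (\<lambda>t. l s t (\<phi> t) * d (r k) t)) \<longlonglongrightarrow> integral {0..1} (\<lambda>t. l s t (\<phi> t) * A t)"
      by (intro quad_tendsto_uniform filterlim_compose[OF m filterlim_subseq[OF r]] m1 continuous_on_mult continuous_on_k s \<phi> A)
    \<comment> \<open>The quadratic linearization remainder M E^2 is still M E after the division,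
      so the limit equation is linear.\<close>
    have 2: "(\<lambda>k. w (r k) s - quad (m (r k)) (\<lambda>t. l s t (\<phi> t) * d (r k) t)) \<longlonglongrightarrow> 0"
    proof (rule Lim_null_comparison)
      show "(\<lambda>k. M * E (r k)) \<longlonglongrightarrow> 0" using tendsto_mult_left[OF Er, of M] by simp
      show "\<forall>\<^sub>F k in sequentially. norm (w (r k) s - quad (m (r k)) (\<lambda>t. l s t (\<phi> t) * d (r k) t)) \<le> M * E (r k)"
      proof (intro always_eventually allI)
        fix k
        let ?k = "r k"
        have "quad (m ?k) (\<lambda>t. l s t (\<phi> t) * d ?k t) = quad (m ?k) (\<lambda>t. l s t (\<phi> t) * (x ?k t - \<phi> t)) / E ?k"
          unfolding d_def quad_divide[symmetric] by simp
        then have "\<bar>w ?k s - quad (m ?k) (\<lambda>t. l s t (\<phi> t) * d ?k t)\<bar>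
            = \<bar>KN (m ?k) (x ?k) s - KN (m ?k) \<phi> s - quad (m ?k) (\<lambda>t. l s t (\<phi> t) * (x ?k t - \<phi> t))\<bar> / E ?k"
          using E(1)[of ?k] unfolding w_def by (simp add: diff_divide_distrib[symmetric])
        also have "\<dots> \<le> M * (E ?k)^2 / E ?k"
          using KN_linearize[OF m1[of ?k] s x[of _ ?k] \<phi>(2) E(3)[of _ ?k]] E(1)[of ?k] by (intro divide_right_mono) auto
        also have "\<dots> = M * E ?k" using E(1)[of ?k] by (simp add: power2_eq_square)
        finally show "norm (w ?k s - quad (m ?k) (\<lambda>t. l s t (\<phi> t) * d ?k t)) \<le> M * E ?k" by simp
      qed
    qed
    from tendsto_add[OF 1 2] have "(\<lambda>k. w (r k) s) \<longlonglongrightarrow> integral {0..1} (\<lambda>t. l s t (\<phi> t) * A t)" by simp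
    moreover have "(\<lambda>k. w (r k) s) \<longlonglongrightarrow> A s" using tendsto_uniform_limitI[OF wA s] .
    ultimately show ?thesis using LIMSEQ_unique by blast
  qed
  then show ?thesis using r A dA unfolding d_def by (intro that[of r A]) auto
qed

end

section \<open>From functions to the normed space\<close>

lemma fn_outside: "t \<notin> {0..1} \<Longrightarrow> fn x t = 0"
  using fn[of x] unfolding linf_set_def by blast

lemma fn_measurable: "fn x \<in> borel_measurable borel"
  using fn[of x] unfolding linf_set_def by blast

lemma abs_fn_le_norm: "\<bar>fn x t\<bar> \<le> norm x"
  unfolding norm_linf_def by (rule fn_le_SUP)

lemma norm_linf_leI:
  assumes "0 \<le> B" "\<And>t. t \<in> {0..1} \<Longrightarrow> \<bar>fn x t\<bar> \<le> B"
  shows "norm x \<le> B"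
  unfolding norm_linf_def
proof (rule cSUP_least)
  show "\<bar>fn x t\<bar> \<le> B" for t using assms fn_outside[of t x] by (cases "t \<in> {0..1}") auto
qed simp

lemma linf_eqI_unit: "(\<And>t. t \<in> {0..1} \<Longrightarrow> fn x t = fn y t) \<Longrightarrow> x = y"
  by (rule linf_eqI) (metis fn_outside)

text \<open>\<open>restr01\<close> goes through the abstraction \<open>Linf\<close>, which is
  informative only for bounded measurable functions; continuity on the compact interval provides
  both.\<close>

lemma fn_restr01:
  assumes g: "continuous_on {0..1} g" and t: "t \<in> {0..1}"
  shows "fn (restr01 g) t = g t"
proof -
  let ?h = "\<lambda>s. if s \<in> {0..1} then g s else 0"
  have "(\<lambda>x. indicator {0..1} x *\<^sub>R g x) \<in> borel_measurable borel"
    using g by (intro borel_measurable_continuous_on_indicator) auto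
  moreover have "(\<lambda>x. indicator {0..1} x *\<^sub>R g x) = ?h" by (auto simp: indicator_def)
  ultimately have m: "?h \<in> borel_measurable borel" by simp
  obtain B where B: "\<forall>y\<in>g ` {0..1}. norm y \<le> B"
    using compact_imp_bounded[OF compact_continuous_image[OF g compact_Icc]] unfolding bounded_iff by blast
  have "\<bar>?h s\<bar> \<le> \<bar>B\<bar>" for s using B by force
  then have "bounded (range ?h)" unfolding bounded_range_real_iff by blast
  then have "?h \<in> linf_set" using m by (auto simp: linf_set_def)
  then show ?thesis using t by (simp add: restr01_def Linf_inverse)
qed

lemma restr01_cong: "(\<And>t. t \<in> {0..1} \<Longrightarrow> g t = h t) \<Longrightarrow> restr01 g = restr01 h"
  unfolding restr01_def by (rule arg_cong[where f=Linf]) auto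

lemma bounded_linear_fn: "bounded_linear (\<lambda>x. fn x t)"
  by (rule bounded_linear_intro[of _ 1]) (use abs_fn_le_norm in auto)

lemma quad_cong: "(\<And>t. t \<in> {0..1} \<Longrightarrow> g t = h t) \<Longrightarrow> quad m g = quad m h"
  unfolding quad_def by (intro arg_cong2[where f="(*)"] sum.cong refl) (metis zeta_in_unit)

lemma Qform_cong:
  assumes n: "n \<ge> 1" and p: "p \<ge> 1" and t: "t \<in> {0..1}" and gh: "\<And>t. t \<in> {0..1} \<Longrightarrow> g t = h t"
  shows "Qform n p g t = Qform n p h t"
proof -
  note P = pidx_in_cell(1)[OF n t]
  show ?thesis
    unfolding Qform_cell_avg
    by (rule cell_avg_cong[OF n p]) (use P gh cell_subset_unit[OF P] in auto)
qed

lemma continuous_on_quad: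
  assumes "\<And>t. t \<in> {0..1} \<Longrightarrow> continuous_on S (\<lambda>s. g s t)"
  shows "continuous_on S (\<lambda>s. quad m (g s))"
  unfolding quad_def by (intro continuous_intros assms zeta_in_unit)

text \<open>Hahn--Banach leaves \<open>Q\<close> undetermined on most of the space, but on sums of a continuous and
  a piecewise constant function, where all iterates live, it is still given by the averaging formula.\<close>

lemma disc_proj_continuous_plus_step:
  assumes Q: "disc_proj n p Q" and n: "n \<ge> 1" and p: "p \<ge> 1"
    and a: "continuous_on {0..1} (fn a)" and b: "b \<in> Xn n" and t: "t \<in> {0..1}"
  shows "fn (blinfun_apply Q (a + b)) t = Qform n p (fn (a + b)) t"
proof -
  let ?j = "pidx n t"
  note P = pidx_in_cell[OF n t]
  have j1: "?j \<ge> 1" using P by auto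
  obtain c where c: "\<And>j t. j \<in> {1..n} \<Longrightarrow> t \<in> piece n j \<Longrightarrow> fn b t = c j"
    using b unfolding Xn_def by blast
  have "fn b u = c ?j" if "(real ?j - 1) / real n < u" "u < real ?j / real n" for u
    using that P(1) by (intro c) (auto simp: piece_def split: if_splits)
  then have "cell_avg n p ?j (fn b) = cell_avg n p ?j (\<lambda>_. c ?j)"
    using n p j1 by (intro cell_avg_cong)
  then have "Qform n p (fn b) t = fn b t"
    using c[OF P(1,2)] p by (simp add: Qform_cell_avg cell_avg_const)
  moreover have "blinfun_apply Q (a + b) = blinfun_apply Q a + b"
    using Q b unfolding disc_proj_def by (simp add: blinfun.add_right)
  moreover have "fn (blinfun_apply Q a) t = Qform n p (fn a) t"
    using Q a t unfolding disc_proj_def by blast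
  ultimately show ?thesis by (simp add: Qform_cell_avg cell_avg_add)
qed

lemma has_real_derivative_quadratic:
  fixes F :: "real \<Rightarrow> real"
  assumes "\<delta> > 0" "\<And>h. \<bar>h\<bar> \<le> \<delta> \<Longrightarrow> \<bar>F h - F 0 - c * h\<bar> \<le> K * h^2"
  shows "(F has_real_derivative c) (at 0)"
proof -
  have "((\<lambda>h. (F (0 + h) - F 0) / h - c) \<longlongrightarrow> 0) (at 0)"
  proof (rule Lim_null_comparison)
    show "((\<lambda>h. K * \<bar>h\<bar>) \<longlongrightarrow> 0) (at 0)"
      by (auto intro!: tendsto_eq_intros)
    have "\<forall>\<^sub>F h in at 0. h \<noteq> 0 \<and> \<bar>h\<bar> < \<delta>"
      unfolding eventually_at using assms(1) by (auto intro!: exI[of _ \<delta>] simp: dist_real_def)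
    then show "\<forall>\<^sub>F h in at 0. norm ((F (0 + h) - F 0) / h - c) \<le> K * \<bar>h\<bar>"
    proof eventually_elim
      case (elim h)
      have "norm ((F (0 + h) - F 0) / h - c) = \<bar>F h - F 0 - c * h\<bar> / \<bar>h\<bar>"
      proof -
        have "(F (0 + h) - F 0) / h - c = (F h - F 0 - c * h) / h" using elim by (simp add: diff_divide_distrib)
        then show ?thesis by simp
      qed
      also have "\<dots> \<le> K * h^2 / \<bar>h\<bar>" using assms(2)[of h] elim by (intro divide_right_mono) auto
      also have "\<dots> = K * \<bar>h\<bar>"
      proof -
        have "K * h^2 = K * \<bar>h\<bar> * \<bar>h\<bar>" by (simp add: power2_eq_square)
        then show ?thesis using elim unfolding \<open>K * h^2 = _\<close> by (subst nonzero_mult_div_cancel_right) auto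
      qed
      finally show ?case .
    qed
  qed
  then show ?thesis unfolding DERIV_def by (rule Lim_null[THEN iffD2])
qed

section \<open>The operators and the Frechet derivative read pointwise\<close>

context kernel_bounds
begin

text \<open>The premise ranges over all real u because the lemma is also applied to
  \<open>Q z\<close>, whose values are not bounded by R before the averaging formula is known to
  hold for it.\<close>

lemma fn_Knys:
  assumes "\<And>t u. t \<in> {0..1} \<Longrightarrow> continuous_on {0..1} (\<lambda>s. \<kappa> s t u)" "s \<in> {0..1}"
  shows "fn (Knys \<kappa> m x) s = KN m (fn x) s"
  using fn_restr01[OF continuous_on_quad[of "{0..1}" "\<lambda>s t. \<kappa> s t (fn x t)" m, OF assms(1)] assms(2)]
  by (simp add: Knys_def KN_def quad_def)

text \<open>The equation itself places z where Q is determined. Nystroem images are continuous in s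
  whatever their argument is, so this can be seen before anything is known about
  \<open>Q z\<close>.\<close>

lemma fn_Ktil_solution:
  assumes kc: "\<And>t u. t \<in> {0..1} \<Longrightarrow> continuous_on {0..1} (\<lambda>s. \<kappa> s t u)"
    and Q: "disc_proj n p Q" and n: "n \<ge> 1" and p: "p \<ge> 1" and f: "continuous_on {0..1} f"
    and eq: "z - Ktil \<kappa> n p Q z = restr01 f" and s: "s \<in> {0..1}"
  shows "fn z s = f s + KT n p (fn z) s"
proof -
  define a where "a = Knys \<kappa> (n*p) z"
  define b where "b = Knys \<kappa> (n*p) (blinfun_apply Q z)"
  have fa: "fn a t = KN (n*p) (fn z) t" and fb0: "fn b t = KN (n*p) (fn (blinfun_apply Q z)) t" if "t \<in> {0..1}" for t
    using fn_Knys[OF kc that, of "n * p"] unfolding a_def b_def by blast+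
  have cKN: "continuous_on {0..1} (KN (n*p) x)" for x
    unfolding KN_def by (intro continuous_on_quad kc)
  have ca: "continuous_on {0..1} (fn a)" and cb: "continuous_on {0..1} (fn b)"
    using continuous_on_cong[THEN iffD2, OF refl _ cKN] fa fb0 by blast+
  have cf: "continuous_on {0..1} (fn (restr01 f))"
    using continuous_on_cong[THEN iffD2, OF refl _ f] fn_restr01[OF f] by blast
  \<comment> \<open>The first bracket is continuous, the second is piecewise constant.\<close>
  have zeq: "z = (restr01 f + b) + (blinfun_apply Q a - blinfun_apply Q b)"
    using eq unfolding Ktil_def a_def b_def by (simp add: algebra_simps)
  have "blinfun_apply Q (a - b) \<in> Xn n" using Q unfolding disc_proj_def by blast
  then have X: "blinfun_apply Q a - blinfun_apply Q b \<in> Xn n" by (simp add: blinfun.diff_right)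
  have "continuous_on {0..1} (fn (restr01 f + b))" using cf cb by (simp add: continuous_on_add)
  from disc_proj_continuous_plus_step[OF Q n p this X]
  have Qz: "fn (blinfun_apply Q z) t = Qform n p (fn z) t" if "t \<in> {0..1}" for t
    using that zeq by metis
  have fb: "fn b t = KN (n*p) (Qform n p (fn z)) t" if "t \<in> {0..1}" for t
    unfolding fb0[OF that] KN_def by (rule quad_cong) (simp add: Qz)
  have "fn (blinfun_apply Q a) s = Qform n p (KN (n*p) (fn z)) s"
    using Q ca s Qform_cong[OF n p s fa] unfolding disc_proj_def by simp
  moreover have "fn (blinfun_apply Q b) s = Qform n p (KN (n*p) (Qform n p (fn z))) s"
    using Q cb s Qform_cong[OF n p s fb] unfolding disc_proj_def by simp
  moreover have "fn z s = fn (restr01 f) s + fn b s + (fn (blinfun_apply Q a) s - fn (blinfun_apply Q b) s)"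
    by (subst zeq) simp
  ultimately show ?thesis using fb[OF s] fn_restr01[OF f s] unfolding KT_def by simp
qed

lemma continuous_on_integral_k:
  assumes "norm x \<le> R"
  shows "continuous_on {0..1} (\<lambda>s. integral {0..1} (\<lambda>t. \<kappa> s t (fn x t)))"
proof -
  have "\<bar>fn x t\<bar> \<le> R" for t using abs_fn_le_norm[of x t] assms by linarith
  then have "M-lipschitz_on {0..1} (\<lambda>s. integral {0..1} (\<lambda>t. \<kappa> s t (fn x t)))"
    using M_nonneg by (auto intro!: lipschitz_onI integral_lipschitz fn_measurable simp: dist_real_def)
  then show ?thesis by (rule lipschitz_on_continuous_on)
qed

lemma fn_Kop:
  assumes "norm x \<le> R" "s \<in> {0..1}"
  shows "fn (Kop \<kappa> x) s = integral {0..1} (\<lambda>t. \<kappa> s t (fn x t))"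
  unfolding Kop_def using fn_restr01[OF continuous_on_integral_k[OF assms(1)] assms(2)] .

text \<open>Differentiability is assumed, but the derivative comes as an abstract operator. It is
  identified by differentiating along the line through \<phi> in direction H and evaluating at s;
  continuous directions suffice since the limit of the rescaled errors is continuous.\<close>

lemma frechet_derivative_Kop:
  assumes diff: "Kop \<kappa> differentiable (at \<phi>)" and \<phi>: "norm \<phi> < R" "continuous_on {0..1} (fn \<phi>)"
    and H: "continuous_on {0..1} (fn H)" and s: "s \<in> {0..1}"
  shows "fn (frechet_derivative (Kop \<kappa>) (at \<phi>) H) s = integral {0..1} (\<lambda>t. l s t (fn \<phi> t) * fn H t)"
proof -
  let ?D = "frechet_derivative (Kop \<kappa>) (at \<phi>)"
  have D: "(Kop \<kappa> has_derivative ?D) (at \<phi>)" using diff frechet_derivative_works by blast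
  define g where "g \<tau> = Kop \<kappa> (\<phi> + \<tau> *\<^sub>R H)" for \<tau>
  have "((\<lambda>\<tau>. \<phi> + \<tau> *\<^sub>R H) has_derivative (\<lambda>\<tau>. \<tau> *\<^sub>R H)) (at 0)"
    by (auto intro!: derivative_eq_intros)
  from has_derivative_compose[OF this, of "Kop \<kappa>" ?D] D
  have "(g has_derivative (\<lambda>\<tau>. ?D (\<tau> *\<^sub>R H))) (at 0)" unfolding g_def by simp
  then have "(g has_vector_derivative ?D H) (at 0)"
    unfolding has_vector_derivative_def by (simp add: linear_cmul[OF has_derivative_linear[OF D]])
  from bounded_linear.has_vector_derivative[OF bounded_linear_fn this, of s]
  have 1: "((\<lambda>\<tau>. fn (g \<tau>) s) has_real_derivative fn (?D H) s) (at 0)"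
    by (simp add: has_real_derivative_iff_has_vector_derivative)
  \<comment> \<open>Chosen so that \<phi> + \<tau> H stays in the ball of radius R where the kernel
    bounds hold.\<close>
  define \<delta> where "\<delta> = (R - norm \<phi>) / (norm H + 1)"
  have H1: "norm H + 1 > 0" by (smt (verit) norm_ge_zero)
  have \<delta>: "\<delta> > 0" unfolding \<delta>_def using \<phi> H1 by simp
  have "((\<lambda>\<tau>. fn (g \<tau>) s) has_real_derivative integral {0..1} (\<lambda>t. l s t (fn \<phi> t) * fn H t)) (at 0)"
  proof (rule has_real_derivative_quadratic[OF \<delta>, where K = "M * (norm H)^2"])
    fix \<tau> :: real assume \<tau>: "\<bar>\<tau>\<bar> \<le> \<delta>"
    have "\<bar>\<tau>\<bar> * norm H \<le> \<delta> * (norm H + 1)" using \<tau> \<delta> by (intro mult_mono) auto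
    also have "\<dots> = R - norm \<phi>" using H1 unfolding \<delta>_def by simp
    finally have nR: "norm (\<phi> + \<tau> *\<^sub>R H) \<le> R" using norm_triangle_ineq[of \<phi> "\<tau> *\<^sub>R H"] by simp
    have \<phi>R: "norm (\<phi> + 0 *\<^sub>R H) \<le> R" using \<phi> by simp
    have b1: "\<bar>fn \<phi> t + \<tau> * fn H t\<bar> \<le> R" for t using abs_fn_le_norm[of "\<phi> + \<tau> *\<^sub>R H" t] nR by simp
    have b0: "\<bar>fn \<phi> t\<bar> \<le> R" for t using abs_fn_le_norm[of \<phi> t] \<phi> by linarith
    have i1: "(\<lambda>t. \<kappa> s t (fn \<phi> t + \<tau> * fn H t)) integrable_on {0..1}"
      by (intro integrable_continuous_real continuous_on_k continuous_intros s \<phi> H b1)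
    have i0: "(\<lambda>t. \<kappa> s t (fn \<phi> t)) integrable_on {0..1}"
      by (intro integrable_continuous_real continuous_on_k s \<phi> b0)
    have il: "(\<lambda>t. l s t (fn \<phi> t) * fn H t) integrable_on {0..1}"
      by (intro integrable_continuous_real continuous_on_mult continuous_on_k s \<phi> b0 H)
    let ?r = "\<lambda>t. \<kappa> s t (fn \<phi> t + \<tau> * fn H t) - \<kappa> s t (fn \<phi> t) - (l s t (fn \<phi> t) * fn H t) * \<tau>"
    have "((\<lambda>t. ?r t) has_integral (fn (g \<tau>) s - fn (g 0) s - integral {0..1} (\<lambda>t. l s t (fn \<phi> t) * fn H t) * \<tau>)) {0..1}"
      unfolding g_def fn_Kop[OF nR s] fn_Kop[OF \<phi>R s] using i1 i0 il
      by (intro has_integral_diff has_integral_mult_left integrable_integral) auto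
    then have "norm (fn (g \<tau>) s - fn (g 0) s - integral {0..1} (\<lambda>t. l s t (fn \<phi> t) * fn H t) * \<tau>)
        \<le> (M * (norm H)^2 * \<tau>^2) * measure lborel (cbox 0 (1::real))"
    proof (intro has_integral_bound)
      fix t :: real assume "t \<in> cbox 0 1"
      then have t: "t \<in> {0..1}" by simp
      have "\<bar>?r t\<bar> \<le> M * (\<tau> * fn H t)^2"
        using k_linearize[OF s t b1[of t] b0[of t]] by (simp add: algebra_simps)
      also have "\<dots> \<le> M * ((norm H)^2 * \<tau>^2)"
        using abs_fn_le_norm[of H t] M_nonneg
        by (intro mult_left_mono) (auto simp: power_mult_distrib mult.commute intro!: mult_left_mono abs_le_square_iff[THEN iffD1])
      finally show "norm (?r t) \<le> M * (norm H)^2 * \<tau>^2" by (simp add: mult.assoc)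
    qed (use M_nonneg in auto)
    then show "\<bar>fn (g \<tau>) s - fn (g 0) s - integral {0..1} (\<lambda>t. l s t (fn \<phi> t) * fn H t) * \<tau>\<bar>
        \<le> M * (norm H)^2 * \<tau>^2" by simp
  qed
  from DERIV_unique[OF 1 this] show ?thesis .
qed

text \<open>Bootstrapping from measurability: the integral operator smooths, so the right-hand side
  of the equation, and with it \<phi>, has the Lipschitz and second-difference bounds.\<close>

lemma solution_regular:
  assumes f: "C2_01 f" and sol: "\<phi> - Kop \<kappa> \<phi> = restr01 f" and \<phi>: "norm \<phi> \<le> R"
  obtains L where "0 \<le> L"
    "\<And>t t'. t \<in> {0..1} \<Longrightarrow> t' \<in> {0..1} \<Longrightarrow> \<bar>fn \<phi> t - fn \<phi> t'\<bar> \<le> L * \<bar>t - t'\<bar>"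
    "\<And>t h. t - h \<in> {0..1} \<Longrightarrow> t + h \<in> {0..1} \<Longrightarrow> \<bar>fn \<phi> (t + h) - 2 * fn \<phi> t + fn \<phi> (t - h)\<bar> \<le> L * h^2"
    "continuous_on {0..1} f"
    "\<And>s. s \<in> {0..1} \<Longrightarrow> fn \<phi> s = f s + integral {0..1} (\<lambda>t. \<kappa> s t (fn \<phi> t))"
proof -
  obtain F where F: "0 \<le> F" "\<And>s s'. s \<in> {0..1} \<Longrightarrow> s' \<in> {0..1} \<Longrightarrow> \<bar>f s - f s'\<bar> \<le> F * \<bar>s - s'\<bar>"
    "\<And>s h. s - h \<in> {0..1} \<Longrightarrow> s + h \<in> {0..1} \<Longrightarrow> \<bar>f (s + h) - 2 * f s + f (s - h)\<bar> \<le> F * h^2"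
    using C2_01_bounds[OF f] by blast
  have "F-lipschitz_on {0..1} f" using F by (auto intro!: lipschitz_onI simp: dist_real_def)
  then have cf: "continuous_on {0..1} f" by (rule lipschitz_on_continuous_on)
  define K where "K s = integral {0..1} (\<lambda>t. \<kappa> s t (fn \<phi> t))" for s
  have b: "\<bar>fn \<phi> t\<bar> \<le> R" for t using abs_fn_le_norm[of \<phi> t] \<phi> by linarith
  have "\<phi> = restr01 f + Kop \<kappa> \<phi>" using sol by (simp add: algebra_simps)
  then have eq: "fn \<phi> s = f s + K s" if "s \<in> {0..1}" for s
    using fn_Kop[OF \<phi> that] fn_restr01[OF cf that] unfolding K_def by (metis plus_linf.rep_eq)
  \<comment> \<open>The 5 M comes from \<open>integral_second_difference\<close> and also covers the
    Lipschitz constant M of the integral.\<close>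
  let ?L = "F + 5 * M"
  have lip: "\<bar>fn \<phi> t - fn \<phi> t'\<bar> \<le> ?L * \<bar>t - t'\<bar>" if t: "t \<in> {0..1}" "t' \<in> {0..1}" for t t'
  proof -
    have "\<bar>K t - K t'\<bar> \<le> M * \<bar>t - t'\<bar>" unfolding K_def by (intro integral_lipschitz t fn_measurable b)
    moreover have "M * \<bar>t - t'\<bar> \<le> 5 * M * \<bar>t - t'\<bar>" using M_nonneg by (intro mult_right_mono) auto
    ultimately show ?thesis using F(2)[OF t] eq t by (simp add: distrib_right)
  qed
  have sd: "\<bar>fn \<phi> (t + h) - 2 * fn \<phi> t + fn \<phi> (t - h)\<bar> \<le> ?L * h^2"
    if t: "t - h \<in> {0..1}" "t + h \<in> {0..1}" for t h
  proof -
    have t0: "t \<in> {0..1}" using t by auto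
    have "\<bar>K (t + h) - 2 * K t + K (t - h)\<bar> \<le> 5 * M * h^2"
    proof (cases "0 \<le> h")
      case True
      then show ?thesis unfolding K_def by (intro integral_second_difference t fn_measurable b)
    next
      case False
      have "\<bar>K (t + (-h)) - 2 * K t + K (t - (-h))\<bar> \<le> 5 * M * (-h)^2"
        unfolding K_def by (intro integral_second_difference fn_measurable b) (use t False in auto)
      then show ?thesis by (simp add: algebra_simps)
    qed
    then show ?thesis using F(3)[OF t] eq[OF t(1)] eq[OF t(2)] eq[OF t0] by (simp add: distrib_right)
  qed
  show ?thesis
    using F(1) M_nonneg lip sd cf eq unfolding K_def by (intro that[of ?L]) auto
qed

end

section \<open>The contradiction argument\<close>

lemma norm_linf_witness:
  assumes "0 \<le> c" "c < norm x"
  obtains t where "t \<in> {0..1}" "c < \<bar>fn x t\<bar>"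
  using norm_linf_leI[of c x] assms by (meson not_le)

theorem theorem4p2:
  fixes \<kappa> :: "real \<Rightarrow> real \<Rightarrow> real \<Rightarrow> real"
    and f :: "real \<Rightarrow> real"
    and \<phi> :: linf
    and Q :: "nat \<Rightarrow> nat \<Rightarrow> (linf \<Rightarrow>\<^sub>L linf)"
    and z :: "nat \<Rightarrow> nat \<Rightarrow> linf"
    and \<delta>0 :: real and N0 :: nat
  assumes kernel: "kernel_G2_2_0 \<kappa>"
    and Kdiff: "twice_frechet_differentiable (Kop \<kappa>)"
    and f_C2: "C2_01 f"
    and phi_sol: "\<phi> - Kop \<kappa> \<phi> = restr01 f"
    and phi_unique: "\<forall>x. x - Kop \<kappa> x = restr01 f \<longrightarrow> x = \<phi>"
    and not_eig: "\<forall>h. frechet_derivative (Kop \<kappa>) (at \<phi>) h = h \<longrightarrow> h = 0"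
    and Q_proj: "\<forall>n\<ge>1. \<forall>p\<ge>1. disc_proj n p (Q n p)"
    and delta0: "\<delta>0 > 0"
    and z_sol: "\<forall>n\<ge>N0. \<forall>p\<ge>1.
        z n p \<in> ball \<phi> \<delta>0 \<and>
        z n p - Ktil \<kappa> n p (Q n p) (z n p) = restr01 f \<and>
        (\<forall>y\<in>ball \<phi> \<delta>0. y - Ktil \<kappa> n p (Q n p) y = restr01 f \<longrightarrow> y = z n p)"
  shows "\<exists>C N. \<forall>n\<ge>N. \<forall>p\<ge>1.
           norm (z n p - \<phi>) \<le> C * max ((1 / (real n * real p))^2) ((1 / real n)^3)"
proof (rule ccontr)
  assume contra: "\<not> ?thesis"
  define \<epsilon> where "\<epsilon> n p = max ((1 / (real n * real p))^2) ((1 / real n)^3)" for n p :: nat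
  \<comment> \<open>One radius for \<phi> and for all discrete solutions in the ball, with strict
    room around \<phi> for the directional derivative.\<close>
  define R where "R = norm \<phi> + \<delta>0 + 1"
  obtain l where l: "\<And>R. \<exists>M. kernel_bounds \<kappa> l R M" using kernel_bounds_exist[OF kernel] by blast
  obtain M where M: "kernel_bounds \<kappa> l R M" using l by blast
  interpret kernel_bounds \<kappa> l R M by (rule M)
  \<comment> \<open>Uses the bounds for radius |u|, since u is arbitrary here.\<close>
  have kc: "continuous_on {0..1} (\<lambda>s. \<kappa> s t u)" if t: "t \<in> {0..1}" for t u
  proof -
    obtain M' where M': "kernel_bounds \<kappa> l \<bar>u\<bar> M'" using l by blast
    have "M'-lipschitz_on {0..1} (\<lambda>s. \<kappa> s t u)"
      using kernel_bounds.k_lip_s[OF M' _ _ t, of _ _ u] kernel_bounds.M_nonneg[OF M']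
      by (auto intro!: lipschitz_onI simp: dist_real_def)
    then show ?thesis by (rule lipschitz_on_continuous_on)
  qed
  have phiR: "norm \<phi> < R" using delta0 by (simp add: R_def)
  have phib: "\<bar>fn \<phi> t\<bar> \<le> R" for t using abs_fn_le_norm[of \<phi> t] phiR by linarith
  obtain L where L: "0 \<le> L"
    "\<And>t t'. t \<in> {0..1} \<Longrightarrow> t' \<in> {0..1} \<Longrightarrow> \<bar>fn \<phi> t - fn \<phi> t'\<bar> \<le> L * \<bar>t - t'\<bar>"
    "\<And>t h. t - h \<in> {0..1} \<Longrightarrow> t + h \<in> {0..1} \<Longrightarrow> \<bar>fn \<phi> (t + h) - 2 * fn \<phi> t + fn \<phi> (t - h)\<bar> \<le> L * h^2"
    and cf: "continuous_on {0..1} f"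
    and phi_eq: "\<And>s. s \<in> {0..1} \<Longrightarrow> fn \<phi> s = f s + integral {0..1} (\<lambda>t. \<kappa> s t (fn \<phi> t))"
    by (rule solution_regular[OF f_C2 phi_sol less_imp_le[OF phiR]]) (rule that; assumption)
  have "L-lipschitz_on {0..1} (fn \<phi>)" using L by (auto intro!: lipschitz_onI simp: dist_real_def)
  then have cphi: "continuous_on {0..1} (fn \<phi>)" by (rule lipschitz_on_continuous_on)

  \<comment> \<open>The negated claim with C = k and a threshold that makes \<open>z n p\<close> a
    solution and forces n > k; nothing is controlled about p.\<close>
  have "\<exists>n p. n \<ge> max N0 (Suc k) \<and> p \<ge> 1 \<and> norm (z n p - \<phi>) > real k * \<epsilon> n p" for k
  proof -
    have "\<exists>n\<ge>max N0 (Suc k). \<exists>p\<ge>1. \<not> norm (z n p - \<phi>) \<le> real k * \<epsilon> n p"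
      using contra unfolding \<epsilon>_def by blast
    then show ?thesis by (auto simp: not_le)
  qed
  then obtain n p where np: "\<And>k. n k \<ge> max N0 (Suc k)" "\<And>k. p k \<ge> 1"
      "\<And>k. norm (z (n k) (p k) - \<phi>) > real k * \<epsilon> (n k) (p k)"
    by metis
  have nN: "n k \<ge> N0" and n1: "n k \<ge> 1" and nk: "k \<le> n k" for k using np(1)[of k] by auto
  have nlim: "filterlim n at_top sequentially"
    by (rule filterlim_at_top_mono[OF filterlim_ident]) (simp add: nk)
  have \<epsilon>0: "\<epsilon> (n k) (p k) > 0" for k
  proof -
    have "0 < (1 / real (n k))^3" using n1[of k] by simp
    then show ?thesis unfolding \<epsilon>_def by (rule less_le_trans) simp
  qed
  define x where "x k = fn (z (n k) (p k))" for k
  define E where "E k = norm (z (n k) (p k) - \<phi>)" for k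
  have Epos: "E k > 0" for k
    using np(3)[of k] \<epsilon>0[of k] unfolding E_def by (smt (verit) mult_nonneg_nonneg of_nat_0_le_iff)
  have xE: "\<bar>x k t - fn \<phi> t\<bar> \<le> E k" for k t
    using abs_fn_le_norm[of "z (n k) (p k) - \<phi>" t] unfolding x_def E_def by simp
  have xb: "\<bar>x k t\<bar> \<le> R" for k t
  proof -
    have "E k < \<delta>0" using z_sol nN[of k] np(2)[of k] unfolding E_def by (auto simp: dist_norm norm_minus_commute)
    then show ?thesis using xE[of k t] abs_fn_le_norm[of \<phi> t] unfolding R_def by linarith
  qed
  have xeq: "x k s = f s + KT (n k) (p k) (x k) s" if s: "s \<in> {0..1}" for k s
    unfolding x_def
    by (rule fn_Ktil_solution[OF kc Q_proj[rule_format] n1 np(2) cf _ s]) (use n1 np nN z_sol in auto)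

  obtain y r where r: "strict_mono (r :: nat \<Rightarrow> nat)" and xy: "uniform_limit {0..1} (\<lambda>k. x (r k)) y sequentially"
    and y: "continuous_on {0..1} y" "\<And>s. s \<in> {0..1} \<Longrightarrow> y s = f s + integral {0..1} (\<lambda>t. \<kappa> s t (y t))"
    by (rule solutions_subseq_converge[OF nlim n1 np(2) cf xb xeq]) auto
  \<comment> \<open>The limit solves the original equation, so uniqueness identifies it; no
    comparison with \<phi> was used to obtain it.\<close>
  have "restr01 y = \<phi>"
  proof -
    have fy: "fn (restr01 y) t = y t" if "t \<in> {0..1}" for t using fn_restr01[OF y(1) that] .
    have "integral {0..1} (\<lambda>t. \<kappa> s t (fn (restr01 y) t)) = y s - f s" if "s \<in> {0..1}" for s
    proof -
      have "integral {0..1} (\<lambda>t. \<kappa> s t (fn (restr01 y) t)) = integral {0..1} (\<lambda>t. \<kappa> s t (y t))"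
        by (rule integral_cong) (simp add: fy)
      then show ?thesis using y(2)[OF that] by simp
    qed
    then have "Kop \<kappa> (restr01 y) = restr01 (\<lambda>s. y s - f s)" unfolding Kop_def by (rule restr01_cong)
    moreover have "continuous_on {0..1} (\<lambda>s. y s - f s)" by (intro continuous_intros y cf)
    ultimately have "restr01 y - Kop \<kappa> (restr01 y) = restr01 f"
      by (intro linf_eqI_unit) (simp add: fy fn_restr01 cf)
    then show ?thesis using phi_unique by blast
  qed
  then have yphi: "y t = fn \<phi> t" if "t \<in> {0..1}" for t using fn_restr01[OF y(1) that] by simp
  have Elim: "(\<lambda>k. E (r k)) \<longlonglongrightarrow> 0"
  proof (rule tendstoI)
    fix e :: real assume e: "e > 0"
    have "\<forall>\<^sub>F k in sequentially. \<forall>t\<in>{0..1}. dist (x (r k) t) (y t) < e/2" using uniform_limitD[OF xy, of "e/2"] e by simp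
    then show "\<forall>\<^sub>F k in sequentially. dist (E (r k)) 0 < e"
    proof eventually_elim
      case (elim k)
      have "E (r k) \<le> e/2"
        unfolding E_def using elim e yphi
        by (intro norm_linf_leI) (auto simp: x_def dist_real_def intro: less_imp_le)
      then show ?case using e Epos[of "r k"] by simp
    qed
  qed
  define C where "C = M * (2 + 4 * L + 5 * L^2)"
  have C0: "0 \<le> C" using M_nonneg L(1) by (simp add: C_def)
  \<comment> \<open>By the choice of the pairs, E exceeds k times the claimed order, and passing to
    the subsequence only increases the index.\<close>
  have ratio: "(\<lambda>k. C * \<epsilon> (n (r k)) (p (r k)) / E (r k)) \<longlonglongrightarrow> 0"
  proof (rule Lim_null_comparison)
    show "(\<lambda>k. C * (1 / real k)) \<longlonglongrightarrow> 0" using tendsto_mult_left[OF lim_1_over_n, of C] by simp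
    show "\<forall>\<^sub>F k in sequentially. norm (C * \<epsilon> (n (r k)) (p (r k)) / E (r k)) \<le> C * (1 / real k)"
      using eventually_gt_at_top[of 0]
    proof eventually_elim
      case (elim k)
      let ?e = "\<epsilon> (n (r k)) (p (r k))"
      have "real k * ?e \<le> real (r k) * ?e"
        using seq_suble[OF r, of k] \<epsilon>0[of "r k"] by (intro mult_right_mono) auto
      also have "\<dots> < E (r k)" using np(3)[of "r k"] by (simp add: E_def)
      finally have "?e / E (r k) \<le> 1 / real k" using elim Epos[of "r k"] by (simp add: field_simps)
      then have "C * (?e / E (r k)) \<le> C * (1 / real k)" using C0 by (rule mult_left_mono)
      moreover have "0 \<le> C * (?e / E (r k))" using C0 \<epsilon>0[of "r k"] Epos[of "r k"] by simp
      ultimately show ?case by simp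
    qed
  qed
  have residual: "\<bar>x k s - fn \<phi> s - (KT (n k) (p k) (x k) s - KT (n k) (p k) (fn \<phi>) s)\<bar> \<le> C * \<epsilon> (n k) (p k)"
    if s: "s \<in> {0..1}" for k s
  proof -
    have "\<bar>KT (n k) (p k) (fn \<phi>) s - integral {0..1} (\<lambda>t. \<kappa> s t (fn \<phi> t))\<bar> \<le> C * \<epsilon> (n k) (p k)"
      unfolding C_def \<epsilon>_def by (rule KT_consistent[OF n1 np(2) s phib L])
    then show ?thesis using xeq[OF s, of k] phi_eq[OF s] by simp
  qed
  obtain A r' where r': "strict_mono (r' :: nat \<Rightarrow> nat)" and A: "continuous_on {0..1} A"
    and dA: "uniform_limit {0..1} (\<lambda>k t. (x (r (r' k)) t - fn \<phi> t) / E (r (r' k))) A sequentially"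
    and eig: "\<And>s. s \<in> {0..1} \<Longrightarrow> A s = integral {0..1} (\<lambda>t. l s t (fn \<phi> t) * A t)"
  proof (rule error_subseq_limit[where n="\<lambda>k. n (r k)" and p="\<lambda>k. p (r k)" and x="\<lambda>k. x (r k)" and \<phi>="fn \<phi>"
        and E="\<lambda>k. E (r k)" and \<epsilon>="\<lambda>k. C * \<epsilon> (n (r k)) (p (r k))"])
    show "filterlim (\<lambda>k. n (r k)) at_top sequentially"
      by (rule filterlim_compose[OF nlim filterlim_subseq[OF r]])
  qed (use n1 np(2) xb cphi phib Epos Elim xE residual ratio in auto)
  have "frechet_derivative (Kop \<kappa>) (at \<phi>) (restr01 A) = restr01 A"
  proof (rule linf_eqI_unit)
    fix s :: real assume s: "s \<in> {0..1}"
    have cA: "continuous_on {0..1} (fn (restr01 A))"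
      using continuous_on_cong[THEN iffD2, OF refl _ A] fn_restr01[OF A] by blast
    have "Kop \<kappa> differentiable (at \<phi>)" using Kdiff unfolding twice_frechet_differentiable_def by blast
    from frechet_derivative_Kop[OF this phiR cphi cA s]
    have "fn (frechet_derivative (Kop \<kappa>) (at \<phi>) (restr01 A)) s = integral {0..1} (\<lambda>t. l s t (fn \<phi> t) * fn (restr01 A) t)" .
    also have "\<dots> = integral {0..1} (\<lambda>t. l s t (fn \<phi> t) * A t)"
      by (rule integral_cong) (simp add: fn_restr01[OF A])
    finally show "fn (frechet_derivative (Kop \<kappa>) (at \<phi>) (restr01 A)) s = fn (restr01 A) s"
      using eig[OF s] fn_restr01[OF A s] by simp
  qed
  then have "restr01 A = 0" using not_eig by blast
  then have A0: "A t = 0" if "t \<in> {0..1}" for t using fn_restr01[OF A that] by simp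
  \<comment> \<open>The limit A vanishes, so some rescaled error is below 1/2 on the whole interval,
    although E is its exact norm before rescaling.\<close>
  have "\<forall>\<^sub>F k in sequentially. \<forall>t\<in>{0..1}. dist ((x (r (r' k)) t - fn \<phi> t) / E (r (r' k))) (A t) < 1/2"
    using uniform_limitD[OF dA, of "1/2"] by simp
  then obtain k where k: "\<And>t. t \<in> {0..1} \<Longrightarrow> \<bar>(x (r (r' k)) t - fn \<phi> t) / E (r (r' k))\<bar> < 1/2"
  proof -
    assume *: "\<And>k. (\<And>t. t \<in> {0..1} \<Longrightarrow> \<bar>(x (r (r' k)) t - fn \<phi> t) / E (r (r' k))\<bar> < 1/2) \<Longrightarrow> thesis"
    obtain k where "\<forall>t\<in>{0..1}. dist ((x (r (r' k)) t - fn \<phi> t) / E (r (r' k))) (A t) < 1/2"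
      using \<open>eventually _ _\<close> unfolding eventually_sequentially by blast
    then show thesis using A0 by (intro *[of k]) (simp add: dist_real_def)
  qed
  let ?k = "r (r' k)"
  \<comment> \<open>The supremum need not be attained, hence a point where the error exceeds half of
    it.\<close>
  obtain t where t: "t \<in> {0..1}" "E ?k / 2 < \<bar>fn (z (n ?k) (p ?k) - \<phi>) t\<bar>"
    using norm_linf_witness[of "E ?k / 2" "z (n ?k) (p ?k) - \<phi>"] Epos[of ?k] unfolding E_def by auto
  then have "1/2 < \<bar>(x ?k t - fn \<phi> t) / E ?k\<bar>" using Epos[of ?k] by (simp add: x_def field_simps)
  then show False using k[OF t(1)] by linarith
qed

end
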